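(* Parallelograms which are on the same base and in the same parallels are equal to one another. That is, if $ABCD$ and $EBCF$ are parallelograms with common side $BC$ such that $A,D,E,F$ lie on a single line parallel to $BC$, then $ABCD$ and $EBCF$ are equal quadrilaterals.
   Context: Setting: elementary (synthetic) Euclidean plane geometry, as axiomatized for example by Hilbert or Tarski, with the Euclidean parallel postulate and line-circle continuity; Archimedes' axiom is not assumed. $\mathbf{B}(X,Y,Z)$ means $Y$ lies strictly between $X$ and $Z$. For segments, "$=$" means congruence. A rectangle is given by an ordered list $PQRS$ of its vertices going around it; its base (width) is $PQ$ and its height is $QR$. Rectangles $PQRS$ and $pqrs$ are congruent if $PQ=pq$ and $QR=qr$. Equal rectangles: given rectangles $R$ and $S$, place congruent copies of them as $FEBG$ (congruent to $R$) and $BMLA$ (congruent to $S$) with $\mathbf{B}(A,B,E)$ and $\mathbf{B}(G,B,M)$, and let $H,K$ be the points such that $ABGH$ and $BMKE$ are rectangles. Then $R$ and $S$ are equal rectangles if and only if $\mathbf{B}(H,B,K)$. A quadrilateral $JKLM$ (not all vertices collinear) is convex if its diagonals meet: there is a point $X$ with $\mathbf{B}(J,X,L)$ and $\mathbf{B}(K,X,M)$. A convex quadrilateral $JKLM$ has two circumscribed rectangles: the rectangle whose side lines are the parallels to $KM$ through $J$ and $L$ and the perpendiculars to $KM$ through $K$ and $M$; and the rectangle obtained by interchanging the roles of the diagonals $KM$ and $JL$. Two quadrilaterals are equal quadrilaterals if one of the circumscribed rectangles of one is equal to one of the circumscribed rectangles of the other. *)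

theory Defs
  imports Main
begin

text \<open>
  The elementary Euclidean plane in Tarski's language: \<open>bet\<close> is non-strict betweenness and
  \<open>congr A B C D\<close> says that the segments \<open>AB\<close> and \<open>CD\<close> are congruent. The axioms are Tarski's for
  dimension two, with line-circle continuity in place of the continuity schema; in particular
  Archimedes' axiom is not assumed.
\<close>

class euclidean_plane =
  fixes bet :: "'a \<Rightarrow> 'a \<Rightarrow> 'a \<Rightarrow> bool"
    and congr :: "'a \<Rightarrow> 'a \<Rightarrow> 'a \<Rightarrow> 'a \<Rightarrow> bool"
  assumes congr_pseudo_refl: "congr A B B A"
    and congr_inner_trans: "congr A B C D \<Longrightarrow> congr A B E F \<Longrightarrow> congr C D E F"
    and congr_identity: "congr A B C C \<Longrightarrow> A = B"
    and segment_construction: "\<exists>E. bet A B E \<and> congr B E C D"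
    and five_segment:
      "A \<noteq> B \<Longrightarrow> bet A B C \<Longrightarrow> bet A' B' C' \<Longrightarrow> congr A B A' B' \<Longrightarrow> congr B C B' C' \<Longrightarrow>
       congr A D A' D' \<Longrightarrow> congr B D B' D' \<Longrightarrow> congr C D C' D'"
    and bet_identity: "bet A B A \<Longrightarrow> A = B"
    and inner_pasch:
      "bet A P C \<Longrightarrow> bet B Q C \<Longrightarrow> \<exists>X. bet P X B \<and> bet Q X A"
    and lower_dimension:
      "\<exists>A B C. \<not> bet A B C \<and> \<not> bet B C A \<and> \<not> bet C A B"
    and upper_dimension:
      "P \<noteq> Q \<Longrightarrow> congr A P A Q \<Longrightarrow> congr B P B Q \<Longrightarrow> congr C P C Q \<Longrightarrow>
       bet A B C \<or> bet B C A \<or> bet C A B"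
    and euclid:
      "bet A D T \<Longrightarrow> bet B D C \<Longrightarrow> A \<noteq> D \<Longrightarrow>
       \<exists>X Y. bet A B X \<and> bet A C Y \<and> bet X T Y"
    \<comment> \<open>A line \<open>UV\<close> through a point \<open>P\<close> strictly inside the circle with centre \<open>C\<close> and radius
      \<open>CR\<close> meets the circle on both sides of \<open>P\<close>.\<close>
    and line_circle:
      "U \<noteq> V \<Longrightarrow> bet U V P \<or> bet V P U \<or> bet P U V \<Longrightarrow>
       bet C Q R \<Longrightarrow> Q \<noteq> R \<Longrightarrow> congr C P C Q \<Longrightarrow>
       \<exists>X Y. X \<noteq> Y \<and> bet X P Y \<and> congr C X C R \<and> congr C Y C R \<and>
         (bet U V X \<or> bet V X U \<or> bet X U V) \<and>
         (bet U V Y \<or> bet V Y U \<or> bet Y U V)"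
begin

definition strict_bet :: "'a \<Rightarrow> 'a \<Rightarrow> 'a \<Rightarrow> bool" where
  "strict_bet X Y Z \<longleftrightarrow> bet X Y Z \<and> X \<noteq> Y \<and> Y \<noteq> Z"

definition col :: "'a \<Rightarrow> 'a \<Rightarrow> 'a \<Rightarrow> bool" where
  "col A B C \<longleftrightarrow> bet A B C \<or> bet B C A \<or> bet C A B"

definition parallel_lines :: "'a \<Rightarrow> 'a \<Rightarrow> 'a \<Rightarrow> 'a \<Rightarrow> bool" where
  "parallel_lines A B C D \<longleftrightarrow>
     A \<noteq> B \<and> C \<noteq> D \<and> \<not> (\<exists>X. col A B X \<and> col C D X)"

text \<open>A right angle at \<open>B\<close>: it is congruent to its supplement.\<close>

definition right_angle :: "'a \<Rightarrow> 'a \<Rightarrow> 'a \<Rightarrow> bool" where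
  "right_angle A B C \<longleftrightarrow>
     B \<noteq> C \<and> (\<exists>X. strict_bet A B X \<and> congr A B X B \<and> congr A C X C)"

definition perpendicular_lines :: "'a \<Rightarrow> 'a \<Rightarrow> 'a \<Rightarrow> 'a \<Rightarrow> bool" where
  "perpendicular_lines A B C D \<longleftrightarrow>
     A \<noteq> B \<and> C \<noteq> D \<and>
     (\<exists>X U V. col A B X \<and> col A B U \<and> col C D X \<and> col C D V \<and> right_angle U X V)"

definition parallelogram :: "'a \<Rightarrow> 'a \<Rightarrow> 'a \<Rightarrow> 'a \<Rightarrow> bool" where
  "parallelogram A B C D \<longleftrightarrow> parallel_lines A B C D \<and> parallel_lines A D B C"

definition rectangle :: "'a \<Rightarrow> 'a \<Rightarrow> 'a \<Rightarrow> 'a \<Rightarrow> bool" where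
  "rectangle P Q R S \<longleftrightarrow>
     right_angle S P Q \<and> right_angle P Q R \<and> right_angle Q R S \<and> right_angle R S P"

definition congruent_rectangles ::
    "'a \<Rightarrow> 'a \<Rightarrow> 'a \<Rightarrow> 'a \<Rightarrow> 'a \<Rightarrow> 'a \<Rightarrow> 'a \<Rightarrow> 'a \<Rightarrow> bool" where
  "congruent_rectangles P Q R S p q r s \<longleftrightarrow>
     rectangle P Q R S \<and> rectangle p q r s \<and> congr P Q p q \<and> congr Q R q r"

text \<open>
  The placement always exists and is unique up to isometry, so it does not matter that it is
  quantified existentially.
\<close>

definition equal_rectangles ::
    "'a \<Rightarrow> 'a \<Rightarrow> 'a \<Rightarrow> 'a \<Rightarrow> 'a \<Rightarrow> 'a \<Rightarrow> 'a \<Rightarrow> 'a \<Rightarrow> bool" where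
  "equal_rectangles P Q R S p q r s \<longleftrightarrow>
     (\<exists>A B E F G H K L M.
        congruent_rectangles P Q R S F E B G \<and>
        congruent_rectangles p q r s B M L A \<and>
        strict_bet A B E \<and> strict_bet G B M \<and>
        rectangle A B G H \<and> rectangle B M K E \<and>
        strict_bet H B K)"

definition convex_quadrilateral :: "'a \<Rightarrow> 'a \<Rightarrow> 'a \<Rightarrow> 'a \<Rightarrow> bool" where
  "convex_quadrilateral J K L M \<longleftrightarrow>
     \<not> (\<exists>U V. U \<noteq> V \<and> col U V J \<and> col U V K \<and> col U V L \<and> col U V M) \<and>
     (\<exists>X. strict_bet J X L \<and> strict_bet K X M)"

text \<open>
  The rectangle circumscribed about \<open>JKLM\<close> along the diagonal \<open>KM\<close>. As rectangles are ordered
  lists, a base has to be chosen: \<open>PQ\<close> is the side through \<open>J\<close>, so the base is parallel to \<open>KM\<close>.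
\<close>

definition circumscribed_along ::
    "'a \<Rightarrow> 'a \<Rightarrow> 'a \<Rightarrow> 'a \<Rightarrow> 'a \<Rightarrow> 'a \<Rightarrow> 'a \<Rightarrow> 'a \<Rightarrow> bool" where
  "circumscribed_along J K L M P Q R S \<longleftrightarrow>
     rectangle P Q R S \<and>
     parallel_lines P Q K M \<and> col P Q J \<and>
     parallel_lines R S K M \<and> col R S L \<and>
     perpendicular_lines S P K M \<and> col S P K \<and>
     perpendicular_lines Q R K M \<and> col Q R M"

text \<open>Shifting the vertices to \<open>KLMJ\<close> interchanges the roles of the two diagonals.\<close>

definition circumscribed_rectangle ::
    "'a \<Rightarrow> 'a \<Rightarrow> 'a \<Rightarrow> 'a \<Rightarrow> 'a \<Rightarrow> 'a \<Rightarrow> 'a \<Rightarrow> 'a \<Rightarrow> bool" where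
  "circumscribed_rectangle J K L M P Q R S \<longleftrightarrow>
     circumscribed_along J K L M P Q R S \<or> circumscribed_along K L M J P Q R S"

definition equal_quadrilaterals ::
    "'a \<Rightarrow> 'a \<Rightarrow> 'a \<Rightarrow> 'a \<Rightarrow> 'a \<Rightarrow> 'a \<Rightarrow> 'a \<Rightarrow> 'a \<Rightarrow> bool" where
  "equal_quadrilaterals J K L M j k l m \<longleftrightarrow>
     convex_quadrilateral J K L M \<and> convex_quadrilateral j k l m \<and>
     (\<exists>P Q R S p q r s.
        circumscribed_rectangle J K L M P Q R S \<and>
        circumscribed_rectangle j k l m p q r s \<and>
        equal_rectangles P Q R S p q r s)"

end

end

theory Submission
  imports Defs
begin

text \<open>
  Put the origin at \<open>C\<close> and write \<open>b\<close>, \<open>p\<close>, \<open>q\<close> for the vectors to \<open>B\<close>, \<open>A\<close>, \<open>E\<close>; the hypothesis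
  on the parallels says that \<open>q - p\<close> is a multiple of \<open>b\<close>. The rectangle circumscribed about \<open>ABCD\<close>
  along the diagonal \<open>CA\<close> has base \<open>|p|\<close>, and its height is twice the distance from \<open>b\<close> to the line
  \<open>p\<close>; the one about \<open>EBCF\<close> along \<open>CE\<close> has base \<open>|q|\<close> and twice the distance from \<open>b\<close> to the line \<open>q\<close>.
  Numerically both areas are twice that of the parallelograms. But equality of rectangles
  is a collinearity, it amounts to the proportion \<open>base : other height = other base : height\<close>, and
  there is no arithmetic of segments to compute with. The proof produces the proportion as a map.

  Let \<open>|q| \<le> |p|\<close>. Choose a rotation \<open>\<rho>\<close> about the origin such that \<open>\<rho> p\<close> projects on the line \<open>p\<close>
  to a point at distance \<open>|q|\<close>, and let \<open>\<mu> z\<close> be the midpoint of \<open>\<rho> z\<close> and \<open>\<rho>\<^sup>-\<^sup>1 z\<close>: this is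
  multiplication by the cosine of the angle of \<open>\<rho>\<close>, so it maps every ray from the origin to itself
  (\<open>scaling_ray\<close>). If moreover \<open>\<mu>\<close> takes a vector \<open>h\<close> orthogonal to \<open>p\<close>, as long as the second
  height, to one as long as the first height, then the placement \<open>A = -h\<close>, \<open>E = \<mu> h\<close>, \<open>G = p\<close>,
  \<open>M = -\<mu> p\<close>, \<open>H = p - h\<close>, \<open>K = \<mu> h - \<mu> p\<close> around the origin has the required betweenness, since
  each of the pairs \<open>(A, E)\<close>, \<open>(G, M)\<close>, \<open>(H, K)\<close> is of the form \<open>(z, -\<mu> z)\<close>
  (\<open>equal_rectangles_of_parallel\<close>).

  For the heights (\<open>heights_matched_by_scaling\<close>), let \<open>\<sigma>\<close> be a reflection that swaps the rays \<open>p\<close>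
  and \<open>q\<close>, so that \<open>\<sigma> q = \<mu> p\<close>. For \<open>t = q - p\<close> one computes \<open>\<mu> (\<sigma> t) + t = \<mu> (\<mu> p) - p\<close>, a multiple
  of \<open>p\<close>. As \<open>b\<close> is a multiple of \<open>t\<close>, the vector \<open>\<mu> (\<sigma> b) + b\<close> is a multiple of \<open>p\<close>, too, and this says
  that the components of \<open>\<mu> (\<sigma> b)\<close> and \<open>-b\<close> orthogonal to \<open>p\<close> agree. The transfer from \<open>t\<close> to \<open>b\<close> needs
  that \<open>\<mu>\<close> and \<open>\<sigma>\<close> commute with all maps of the kind of \<open>\<mu>\<close>. This is what replaces the
  commutative law for products of segments, and it comes from the theorem of the three reflections:
  a product of reflections in three concurrent lines is a reflection (\<open>three_refl_in\<close>), so that these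
  reflections conjugate rotations to their inverses, and rotations commute.

  Vectors are added by point reflections. That they form an abelian group is the statement that a
  product of three point reflections is a point reflection (\<open>three_point_refls\<close>). This is the point
  where the parallel postulate enters, in Playfair's form: a product of point reflections
  maps every line to a parallel one, so as soon as it fixes a point it fixes all lines through it.
  What comes before is the part of plane geometry that these arguments presuppose: order and
  congruence, midpoints, perpendiculars, Pasch's axiom.
\<close>

context euclidean_plane
begin

section \<open>Congruence and betweenness\<close>

lemma congr_refl: "congr A B A B"
  using congr_inner_trans congr_pseudo_refl by blast

lemma congr_sym: "congr A B C D \<Longrightarrow> congr C D A B"
  using congr_inner_trans congr_refl by blast

lemma congr_trans: "congr A B C D \<Longrightarrow> congr C D E F \<Longrightarrow> congr A B E F"
  using congr_inner_trans congr_sym by blast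

lemma congr_left: "congr A B C D \<Longrightarrow> congr B A C D"
  using congr_inner_trans congr_pseudo_refl by blast

lemma congr_right: "congr A B C D \<Longrightarrow> congr A B D C"
  using congr_left congr_sym by blast

lemma congr_both: "congr A B C D \<Longrightarrow> congr B A D C"
  using congr_left congr_right by blast

text \<open>
  The length of a segment is its congruence class, which turns chains of congruences into
  equational reasoning.
\<close>

definition len :: "'a \<Rightarrow> 'a \<Rightarrow> ('a \<times> 'a) set" where
  "len A B = {(C, D). congr A B C D}"

lemma congr_len: "congr A B C D \<longleftrightarrow> len A B = len C D"
proof
  assume "congr A B C D"
  then show "len A B = len C D"
    unfolding len_def using congr_trans congr_sym by blast
next
  assume "len A B = len C D"
  then have "(C, D) \<in> len A B" unfolding len_def using congr_refl by blast
  then show "congr A B C D" unfolding len_def by blast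
qed

lemma len_comm: "len A B = len B A"
  using congr_pseudo_refl congr_len by blast

lemma congr_null: "congr A A B B"
  using segment_construction[of A A B B] congr_identity by blast

lemma congr_null_iff: "congr A B C D \<Longrightarrow> A = B \<longleftrightarrow> C = D"
  using congr_identity congr_sym by blast

lemma congr_add:
  assumes "bet A B C" "bet A' B' C'" "congr A B A' B'" "congr B C B' C'"
  shows "congr A C A' C'"
proof (cases "A = B")
  case True
  then show ?thesis using assms congr_null_iff by blast
next
  case False
  have "congr C A C' A'"
    by (rule five_segment[OF False assms congr_null congr_both[OF assms(3)]])
  then show ?thesis by (rule congr_both)
qed

lemma extension_unique:
  assumes "Q \<noteq> A" "bet Q A X" "bet Q A Y" "congr A X A Y"
  shows "X = Y"
proof -
  have "congr Q X Q Y"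
    using congr_add[OF assms(2,3) congr_refl assms(4)] .
  then have "congr X X X Y"
    using five_segment[OF assms(1,2,2) congr_refl congr_refl _ assms(4)] by blast
  then show ?thesis using congr_null_iff by blast
qed

lemma bet_triv2: "bet A B B"
proof -
  obtain E where "bet A B E" "congr B E B B" using segment_construction by blast
  then show ?thesis using congr_identity by blast
qed

lemma bet_sym: "bet A B C \<Longrightarrow> bet C B A"
  using inner_pasch[of A B C B C] bet_triv2 bet_identity by blast

lemma bet_triv1: "bet A A B"
  using bet_triv2 bet_sym by blast

lemma bet_antisym: "bet A B C \<Longrightarrow> bet B A C \<Longrightarrow> A = B"
  using inner_pasch[of A B C B A] bet_identity by metis

lemma bet_inner_trans: "bet A B D \<Longrightarrow> bet B C D \<Longrightarrow> bet A B C"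
  using inner_pasch[of A B D B C] bet_identity bet_sym by metis

lemma bet_exchange3: "bet A B C \<Longrightarrow> bet A C D \<Longrightarrow> bet B C D"
  using bet_inner_trans bet_sym by metis

lemma bet_outer_trans:
  assumes "bet A B C" "bet B C D" "B \<noteq> C"
  shows "bet A C D"
proof -
  obtain E where E: "bet A C E" "congr C E C D" using segment_construction by blast
  then have "bet B C E" using assms(1) bet_exchange3 by blast
  then have "E = D" using extension_unique assms(2,3) E by blast
  then show ?thesis using E by blast
qed

lemma bet_outer_trans': 
  assumes "bet A B C" "bet B C D" "B \<noteq> C"
  shows "bet A B D"
  using bet_outer_trans[of D C B A] assms bet_sym by blast

lemma bet_exchange2:
  assumes "bet A B D" "bet B C D"
  shows "bet A C D"
  using assms bet_inner_trans bet_outer_trans bet_triv2 by metis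

lemma bet_exchange4:
  assumes "bet A B C" "bet A C D"
  shows "bet A B D"
  using assms bet_exchange2 bet_sym by blast

lemma point_beyond: "\<exists>C. bet A B C \<and> B \<noteq> C"
proof -
  obtain P Q R where PQ: "\<not> bet P Q R" using lower_dimension by blast
  then have ne: "P \<noteq> Q" using bet_triv1 by blast
  obtain C where "bet A B C" "congr B C P Q" using segment_construction by blast
  then show ?thesis using ne congr_null_iff by blast
qed

text \<open>
  Two applications of inner Pasch: the first one gives the point where \<open>PC\<close> crosses \<open>AB'\<close>, the
  second one moves it on to \<open>BB'\<close>.
\<close>

lemma pasch_cevian:
  assumes "bet A B C" "bet A' B' C" "bet A P A'"
  shows "\<exists>Q. bet P Q C \<and> bet B Q B'"
proof -
  obtain X where X: "bet P X C" "bet B' X A"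
    using inner_pasch[OF assms(3) bet_sym[OF assms(2)]] bet_sym inner_pasch assms by metis
  obtain Y where "bet X Y C" "bet B Y B'"
    using inner_pasch[of A B C B' X] inner_pasch X assms bet_sym by metis
  then show ?thesis using X bet_exchange2 by blast
qed

text \<open>
  The five-segment axiom with the extra point hanging over the middle of the segment rather than over an end;
  extending both segments beyond \<open>C\<close> reduces it to the axiom, read twice.
\<close>

lemma inner_five_segment:
  assumes "bet A B C" "bet A' B' C'" "congr A C A' C'" "congr B C B' C'"
    "congr A D A' D'" "congr C D C' D'"
  shows "congr B D B' D'"
proof (cases "A = C")
  case True
  then show ?thesis using assms bet_identity congr_null_iff by metis
next
  case False
  obtain E where E: "bet A C E" "C \<noteq> E" using point_beyond by blast
  obtain E' where E': "bet A' C' E'" "congr C' E' C E" using segment_construction by blast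
  have 1: "congr E D E' D'"
    using five_segment[OF False E(1) E'(1) assms(3) congr_sym[OF E'(2)] assms(5,6)] .
  have 2: "bet E C B" "bet E' C' B'"
    using E E' assms bet_exchange3 bet_sym by blast+
  show ?thesis
    using five_segment[OF _ 2(1) 2(2) _ _ 1 assms(6)] E(2)
      congr_both[OF congr_sym[OF E'(2)]] congr_both[OF assms(4)] by blast
qed

lemma congr_sub:
  assumes "bet A B C" "bet A' B' C'" "congr A C A' C'" "congr B C B' C'"
  shows "congr A B A' B'"
  using inner_five_segment[OF assms congr_null congr_both[OF assms(3)]] congr_both by blast

lemma congr_sub':
  assumes "bet A B C" "bet A' B' C'" "congr A C A' C'" "congr A B A' B'"
  shows "congr B C B' C'"
  using congr_sub[of C B A C' B' A'] assms bet_sym congr_both by blast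

lemma opposite_ray: "\<exists>Q. bet Q A B \<and> Q \<noteq> A"
  using point_beyond bet_sym by metis

lemma copy_subdivision:
  assumes "bet A B C" "congr A C A' C'"
  shows "\<exists>B'. bet A' B' C' \<and> congr A B A' B' \<and> congr B C B' C'"
proof -
  obtain Q where Q: "bet Q A' C'" "Q \<noteq> A'" using opposite_ray by blast
  obtain B' where B': "bet Q A' B'" "congr A' B' A B" using segment_construction by blast
  obtain C'' where C'': "bet Q B' C''" "congr B' C'' B C" using segment_construction by blast
  have b: "bet A' B' C''" using B' C'' bet_exchange3 by blast
  have "congr A C A' C''"
    using congr_add[OF assms(1) b] B' C'' congr_sym by blast
  moreover have "bet Q A' C''" using B' C'' bet_exchange4 by blast
  ultimately have "C'' = C'"
    using extension_unique Q assms(2) congr_inner_trans by blast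
  then show ?thesis using b B' C'' congr_sym by blast
qed

lemma bet_congr:
  assumes "bet A B C" "congr A B A' B'" "congr B C B' C'" "congr A C A' C'"
  shows "bet A' B' C'"
proof -
  obtain X where X: "bet A' X C'" "congr A B A' X" "congr B C X C'"
    using copy_subdivision assms by blast
  have "congr X B' X X"
    using inner_five_segment[OF X(1) X(1) congr_refl congr_refl, of X B'] 
    using X assms congr_inner_trans congr_both
    by (meson inner_five_segment congr_refl congr_sym)
  then have "X = B'" using congr_identity by blast
  then show ?thesis using X by blast
qed

text \<open>
  Order on a line is total, but this has to be derived from congruence: if neither
  alternative held, laying off the segment \<open>CD\<close> beyond \<open>C\<close> and beyond \<open>D\<close> would produce a rhombus
  \<open>C D C' D'\<close> with diagonals meeting at \<open>E\<close>, and congruences show that this rhombus is degenerate.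
\<close>

lemma bet_connectivity:
  assumes AB: "A \<noteq> B" and C: "bet A B C" and D: "bet A B D"
  shows "bet A C D \<or> bet A D C"
proof (rule ccontr)
  assume neg: "\<not> ?thesis"
  then have ne: "B \<noteq> C" "C \<noteq> D" using D bet_triv2 by blast+
  obtain C' where C': "bet A D C'" "congr D C' C D" using segment_construction by blast
  obtain D' where D': "bet A C D'" "congr C D' C D" using segment_construction by blast
  obtain B' where B': "bet A C' B'" "congr C' B' C B" using segment_construction by blast
  obtain B'' where B'': "bet A D' B''" "congr D' B'' D B" using segment_construction by blast
  have b1: "bet B D C'" "bet B C D'" using C D C' D' bet_exchange3 by blast+
  have b2: "bet A B C'" "bet A B D'" using C D C' D' bet_exchange4 by blast+
  have b3: "bet B C' B'" "bet D C' B'" "bet C D' B''" "bet B D' B''"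
    using B' B'' b2 C' D' bet_exchange3 by blast+
  have b4: "bet B C B''" using b1 b3 bet_exchange4 by blast
  have "congr B C' B'' C"
    using congr_add[OF b1(1) bet_sym[OF b3(3)]] congr_both[OF congr_sym[OF B''(2)]]
      congr_trans[OF C'(2) congr_sym[OF D'(2)]] congr_right congr_left by blast
  then have BB: "congr B B' B'' B"
    using congr_add[OF b3(1) bet_sym[OF b4]] B'(2) by blast
  have "bet A B B'" "bet A B B''" using b2 B' B'' bet_exchange4 by blast+
  \<comment> \<open>both lie on the ray \<open>AB\<close> at the distance \<open>BB'\<close> from \<open>B\<close>\<close>
  then have eq: "B'' = B'" using extension_unique AB BB congr_right congr_sym by blast
  have c1: "congr D' C' D C"
  proof (rule five_segment[OF ne(1) b1(2) bet_sym[OF b3(2)[unfolded eq]]])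
    show "congr B C B' C'" using B'(2) congr_sym congr_both by blast
    show "congr C D' C' D" using D' C' congr_trans congr_sym congr_left by blast
    show "congr B C' B' C" using \<open>congr B C' B'' C\<close> eq by blast
    show "congr C C' C' C" by (rule congr_pseudo_refl)
  qed
  obtain E where E: "bet C E C'" "bet D E D'"
    using inner_pasch[OF bet_sym[OF b1(2)] bet_sym[OF b1(1)]] by blast
  have EC: "congr E C E C'"
    using inner_five_segment[OF E(2) E(2) congr_refl congr_refl, of C C']
      C' D' c1 congr_left congr_right congr_sym congr_trans by meson
  have ED: "congr E D E D'"
    using inner_five_segment[OF E(1) E(1) congr_refl congr_refl, of D D']
      C' D' c1 congr_left congr_right congr_sym congr_trans by meson
  have CC: "C \<noteq> C'" using neg C' by blast
  have DD: "D \<noteq> D'" using neg D' by blast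
  \<comment> \<open>\<open>C R P\<close> is a copy of the triangle \<open>C E D'\<close>, and \<open>Q\<close> is the reflection of \<open>P\<close> in \<open>R\<close>. The points \<open>P\<close>
    and \<open>Q\<close> come out equidistant from \<open>C\<close>, \<open>D'\<close>, \<open>B\<close> and finally \<open>C'\<close>; as \<open>P\<close> is on the line \<open>C'C\<close>, this
    forces \<open>P = Q\<close>.\<close>
  obtain P where P: "bet C' C P" "congr C P C D'" using segment_construction by blast
  obtain R where R: "bet D' C R" "congr C R C E" using segment_construction by blast
  obtain Q where Q: "bet P R Q" "congr R Q R P" using segment_construction by blast
  have CD': "C \<noteq> D'" using D' ne congr_null_iff by blast
  have ED': "E \<noteq> D'" using ED DD congr_null_iff by blast
  have "bet P C E" using P E bet_sym bet_inner_trans by meson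
  then have RP: "congr R P E D'"
    using five_segment[OF CD'[symmetric] R(1) _ _ R(2) congr_pseudo_refl P(2)] 
      congr_both[OF congr_sym[OF P(2)]] by blast
  have "congr D C Q C"
  proof (rule five_segment[OF ED'[symmetric] bet_sym[OF E(2)] Q(1)])
    show "congr D' E P R" using RP congr_both congr_sym by blast
    show "congr E D R Q" using ED Q RP congr_trans congr_sym by meson
    show "congr D' C P C" using P congr_both congr_sym by blast
    show "congr E C R C" using R congr_both congr_sym by blast
  qed
  then have CPQ: "congr C P C Q" using P D' congr_trans congr_both congr_sym by meson
  have RPQ: "congr R P R Q" using Q congr_sym by blast
  have RC: "R \<noteq> C" using R EC CC congr_null_iff by blast
  have x1: "congr D' P D' Q"
    using five_segment[OF RC bet_sym[OF R(1)] bet_sym[OF R(1)] congr_refl congr_refl RPQ CPQ] .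
  have x2: "congr B P B Q"
    using five_segment[OF CD'[symmetric] bet_sym[OF b1(2)] bet_sym[OF b1(2)] congr_refl congr_refl x1 CPQ] .
  have x3: "congr B' P B' Q"
    using five_segment[OF CD' b3(3) b3(3) congr_refl congr_refl CPQ x1] eq by blast
  have x4: "congr C' P C' Q"
    using inner_five_segment[OF b3(1) b3(1) congr_refl congr_refl x2 x3] .
  have "congr P P P Q"
    using five_segment[OF CC[symmetric] P(1) P(1) congr_refl congr_refl x4 CPQ] .
  then have "P = Q" using congr_null_iff by blast
  then have "R = P" using Q bet_identity by blast
  then show False using RP ED' congr_null_iff by blast
qed

lemma bet_connectivity_from:
  assumes "A \<noteq> B" "bet A B C" "bet A B D"
  shows "bet B C D \<or> bet B D C"
  using bet_connectivity[OF assms] assms bet_exchange3 by blast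

lemma bet_connectivity_within:
  assumes "bet A B D" "bet A C D"
  shows "bet A B C \<or> bet A C B"
proof -
  obtain Q where Q: "bet D A Q" "A \<noteq> Q" using point_beyond by blast
  have "bet Q A B" "bet Q A C" using Q assms bet_sym bet_inner_trans by meson+
  then show ?thesis using bet_connectivity_from[of Q A B C] Q by blast
qed

section \<open>Collinearity, comparison of segments, rays\<close>

lemma col_swap: "col A B C \<Longrightarrow> col B A C"
  and col_rot: "col A B C \<Longrightarrow> col B C A"
  unfolding col_def using bet_sym by blast+

lemma col_triv: "col A A B" "col A B A" "col A B B"
  unfolding col_def using bet_triv1 bet_triv2 by blast+

lemma bet_col: "bet A B C \<Longrightarrow> col A B C"
  unfolding col_def by blast

lemma col_trans_through:
  assumes "P \<noteq> Q" "col P Q A" "col P Q B"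
  shows "col P A B"
proof (cases "A = P \<or> B = P")
  case True
  then show ?thesis using col_triv by blast
next
  case False
  note ex = bet_exchange2 bet_exchange3 bet_exchange4 bet_inner_trans bet_outer_trans bet_outer_trans'
  have a: "bet P Q A \<or> bet P A Q \<or> bet A P Q" and b: "bet P Q B \<or> bet P B Q \<or> bet B P Q"
    using assms unfolding col_def using bet_sym by blast+
  have "bet P A B \<or> bet P B A \<or> bet A P B"
    using a b
  proof (elim disjE)
    assume "bet P Q A" "bet P Q B" then show ?thesis using bet_connectivity assms(1) by blast
  next
    assume "bet P Q A" "bet P B Q" then show ?thesis using bet_exchange4 by blast
  next
    assume "bet P Q A" "bet B P Q" then show ?thesis using bet_outer_trans' assms(1) bet_sym by meson
  next
    assume "bet P A Q" "bet P Q B" then show ?thesis using bet_exchange4 by blast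
  next
    assume "bet P A Q" "bet P B Q" then show ?thesis using bet_connectivity_within by blast
  next
    assume "bet P A Q" "bet B P Q" then show ?thesis using bet_inner_trans bet_sym by meson
  next
    assume "bet A P Q" "bet P Q B" then show ?thesis using bet_outer_trans' assms(1) bet_sym by meson
  next
    assume "bet A P Q" "bet P B Q" then show ?thesis using bet_inner_trans bet_sym by meson
  next
    assume "bet A P Q" "bet B P Q"
    then show ?thesis using bet_connectivity_from[of Q P A B] assms(1) bet_sym by blast
  qed
  then show ?thesis unfolding col_def using bet_sym by blast
qed

lemma col_of_line:
  assumes "P \<noteq> Q" "col P Q A" "col P Q B" "col P Q C"
  shows "col A B C"
proof (cases "A = P")
  case True
  then show ?thesis using col_trans_through assms by blast
next
  case False
  have "col P A B" "col P A C" using col_trans_through assms by blast+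
  then show ?thesis using col_trans_through[of A P B C] False col_swap by blast
qed

text \<open>
  The workhorse for membership in lines: a point of the line through two points of \<open>PQ\<close> is on \<open>PQ\<close>.
\<close>

lemma line_change:
  assumes "A \<noteq> B" "col P Q A" "col P Q B" "col A B C" "P \<noteq> Q"
  shows "col P Q C"
proof -
  have "col A B P" "col A B Q" 
    using col_of_line[OF assms(5,2,3)] col_triv by blast+
  then show ?thesis using col_of_line[OF assms(1), of P Q C] assms(4) by blast
qed

lemma col_congr:
  assumes "col A B C" "congr A B A' B'" "congr B C B' C'" "congr A C A' C'"
  shows "col A' B' C'"
  using assms(1) unfolding col_def
  using bet_congr[OF _ assms(2-4)] bet_congr[of B C A B' C' A'] bet_congr[of C A B C' A' B']
    assms(2-4) congr_both by blast

text \<open>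
  The five-segment axiom in any order of the three collinear points.
\<close>

lemma five_segment_col:
  assumes "col A B C" "A \<noteq> B" "congr A B A' B'" "congr B C B' C'" "congr A C A' C'"
    "congr A D A' D'" "congr B D B' D'"
  shows "congr C D C' D'"
  using assms(1) unfolding col_def
proof (elim disjE)
  assume b: "bet A B C"
  then show ?thesis using five_segment[OF assms(2) b] bet_congr assms by blast
next
  assume b: "bet B C A"
  show ?thesis using inner_five_segment[OF b, of B' C' A'] bet_congr[OF b, of B' C' A'] 
    assms congr_both by blast
next
  assume b: "bet C A B"
  then show ?thesis using five_segment[of B A C B' A' C' D D'] bet_congr[OF b, of C' A' B'] 
    assms congr_both bet_sym by blast
qed

lemma col_equidistant:
  assumes "A \<noteq> B" "col A B C" "congr A P A Q" "congr B P B Q"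
  shows "congr C P C Q"
  using five_segment_col[OF assms(2,1) congr_refl congr_refl congr_refl assms(3,4)] .

lemma col_point_unique:
  assumes "A \<noteq> B" "col A B C" "congr A C A C'" "congr B C B C'"
  shows "C = C'"
  using col_equidistant[OF assms] congr_null_iff by blast

definition seg_le :: "'a \<Rightarrow> 'a \<Rightarrow> 'a \<Rightarrow> 'a \<Rightarrow> bool" where
  "seg_le A B C D \<longleftrightarrow> (\<exists>Y. bet C Y D \<and> congr A B C Y)"

lemma seg_le_total: "seg_le A B C D \<or> seg_le C D A B"
proof -
  obtain Q where Q: "bet Q A B" "Q \<noteq> A" using opposite_ray by blast
  obtain X where X: "bet Q A X" "congr A X C D" using segment_construction by blast
  have "bet A B X \<or> bet A X B" using bet_connectivity_from Q X by blast
  then show ?thesis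
  proof
    assume b: "bet A B X"
    then show ?thesis using copy_subdivision[OF b X(2)] unfolding seg_le_def by blast
  next
    assume "bet A X B" then show ?thesis using X congr_sym unfolding seg_le_def by blast
  qed
qed

lemma seg_le_congr:
  assumes "seg_le A B C D" "congr A B A' B'" "congr C D C' D'"
  shows "seg_le A' B' C' D'"
proof -
  obtain Y where Y: "bet C Y D" "congr A B C Y" using assms seg_le_def by blast
  then obtain Y' where "bet C' Y' D'" "congr C Y C' Y'" using copy_subdivision assms(3) by blast
  then show ?thesis unfolding seg_le_def using Y assms congr_trans congr_sym by meson
qed

definition same_ray :: "'a \<Rightarrow> 'a \<Rightarrow> 'a \<Rightarrow> bool" where
  "same_ray P A B \<longleftrightarrow> A \<noteq> P \<and> B \<noteq> P \<and> (bet P A B \<or> bet P B A)"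

lemma same_ray_sym: "same_ray P A B \<Longrightarrow> same_ray P B A"
  unfolding same_ray_def by blast

lemma same_ray_trans:
  assumes "same_ray P A B" "same_ray P B C"
  shows "same_ray P A C"
  using assms unfolding same_ray_def
  using bet_exchange4 bet_connectivity bet_connectivity_within by metis

lemma same_ray_or_opposite:
  assumes "col P A B" "A \<noteq> P" "B \<noteq> P"
  shows "same_ray P A B \<or> bet A P B"
  using assms unfolding col_def same_ray_def using bet_sym by blast

lemma ray_seg_le_bet:
  assumes "same_ray P A B" "seg_le P A P B"
  shows "bet P A B"
proof (rule ccontr)
  assume n: "\<not> bet P A B"
  then have b: "bet P B A" "P \<noteq> B" "P \<noteq> A" using assms unfolding same_ray_def by blast+
  obtain Y where Y: "bet P Y B" "congr P A P Y" using assms seg_le_def by blast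
  have y: "bet P Y A" using Y b bet_exchange4 by blast
  have "congr Y A A A" using congr_sub'[OF y bet_triv2 congr_refl congr_sym[OF Y(2)]] .
  then have "Y = A" using congr_identity by blast
  then show False using n Y by blast
qed

lemma lay_off: "A \<noteq> P \<Longrightarrow> C \<noteq> D \<Longrightarrow> \<exists>B. same_ray P A B \<and> congr P B C D"
proof -
  assume ne: "A \<noteq> P" "C \<noteq> D"
  obtain Q where Q: "bet Q P A" "Q \<noteq> P" using opposite_ray by blast
  obtain B where B: "bet Q P B" "congr P B C D" using segment_construction by blast
  have "bet P A B \<or> bet P B A" using bet_connectivity_from Q B by blast
  then show ?thesis using B ne congr_null_iff unfolding same_ray_def by metis
qed

section \<open>Midpoints and point reflections\<close>

definition midp :: "'a \<Rightarrow> 'a \<Rightarrow> 'a \<Rightarrow> bool" where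
  "midp M A B \<longleftrightarrow> bet A M B \<and> congr A M M B"

lemma midp_sym: "midp M A B \<Longrightarrow> midp M B A"
  unfolding midp_def using bet_sym congr_both congr_sym by blast

lemma midp_congr: "midp M A B \<Longrightarrow> congr M A M B"
  unfolding midp_def using congr_left by blast

lemma midp_same: "midp M A A \<longleftrightarrow> M = A"
  unfolding midp_def using bet_identity bet_triv1 congr_refl by blast

lemma midp_start: "midp M M B \<longleftrightarrow> M = B"
  unfolding midp_def using congr_null_iff bet_triv1 congr_refl by metis

lemma midp_end: "midp M B M \<longleftrightarrow> M = B"
  using midp_start midp_sym by blast

lemma midp_exists_unique: "\<exists>!B. midp M A B"
proof -
  obtain B where B: "bet A M B" "congr M B A M" using segment_construction by blast
  show ?thesis
  proof (rule ex1I)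
    show "midp M A B" unfolding midp_def using B congr_sym by blast
    fix B' assume "midp M A B'"
    then show "B' = B" 
      using extension_unique[of A M B' B] B congr_null_iff midp_start congr_inner_trans congr_sym
      unfolding midp_def by metis
  qed
qed

definition point_refl :: "'a \<Rightarrow> 'a \<Rightarrow> 'a" where
  "point_refl M A = (THE B. midp M A B)"

lemma point_refl_midp: "midp M A (point_refl M A)"
  unfolding point_refl_def using theI'[OF midp_exists_unique] .

lemma point_refl_eq: "midp M A B \<Longrightarrow> point_refl M A = B"
  using point_refl_midp midp_exists_unique by blast

lemma point_refl_invol [simp]: "point_refl M (point_refl M A) = A"
  using point_refl_eq point_refl_midp midp_sym by blast

lemma point_refl_centre [simp]: "point_refl M M = M"
  using point_refl_eq midp_same by blast

lemma point_refl_fixed: "point_refl M A = A \<longleftrightarrow> A = M"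
  using point_refl_midp midp_same point_refl_centre by metis

lemma point_refl_bet: "bet A M (point_refl M A)"
  using point_refl_midp midp_def by blast

lemma point_refl_radius: "congr M (point_refl M A) M A"
  using point_refl_midp midp_congr congr_sym by blast

text \<open>
  Extend \<open>PP'\<close> at both ends by \<open>MQ\<close> and \<open>QQ'\<close> at both ends by \<open>MP\<close>. The four new points \<open>X\<close>, \<open>X'\<close>, \<open>Y\<close>,
  \<open>Y'\<close> are at the same distance from \<open>M\<close>, so the congruence is first obtained for them and then carried
  inwards to \<open>P\<close>, \<open>Q\<close>.
\<close>

lemma point_refl_isometry: "congr (point_refl M P) (point_refl M Q) P Q"
proof (cases "P = M \<or> Q = M")
  case True
  then show ?thesis
    using point_refl_radius congr_both by fastforce
next
  case False
  define P' where "P' = point_refl M P"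
  define Q' where "Q' = point_refl M Q"
  have m: "bet P M P'" "congr M P' M P" "bet Q M Q'" "congr M Q' M Q" "P' \<noteq> M" "Q' \<noteq> M"
    unfolding P'_def Q'_def using point_refl_bet point_refl_radius False point_refl_invol 
      point_refl_centre by metis+
  obtain X where X: "bet P' P X" "congr P X Q M" using segment_construction by blast
  obtain X' where X': "bet P P' X'" "congr P' X' Q M" using segment_construction by blast
  obtain Y where Y: "bet Q' Q Y" "congr Q Y P M" using segment_construction by blast
  obtain Y' where Y': "bet Q Q' Y'" "congr Q' Y' P M" using segment_construction by blast
  have b: "bet M P X" "bet M P' X'" "bet M Q Y" "bet M Q' Y'"
    using m X X' Y Y' bet_exchange3 bet_sym by meson+
  have XX: "bet X M X'"
    using b m False bet_outer_trans bet_outer_trans' bet_sym by metis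
  have YY: "bet Y M Y'"
    using b m False bet_outer_trans bet_outer_trans' bet_sym by metis
  have l1: "congr M X M X'" 
    using congr_add[OF b(1) b(2)] m X X' congr_sym congr_trans by blast
  have "congr Y M M X"
    using congr_add[OF bet_sym[OF b(3)] b(1)] X Y congr_both congr_sym by blast
  then have l2: "congr M X M Y" using congr_sym congr_right by blast
  have l3: "congr M Y M Y'" 
    using congr_add[OF b(3) b(4)] m Y Y' congr_sym congr_trans by blast
  have XM: "X \<noteq> M" using b False bet_identity by blast
  have d: "congr X' Y' Y X"
  proof (rule five_segment[OF XM XX bet_sym[OF YY]])
    show "congr X M Y' M" using l2 l3 congr_trans congr_both by blast
    show "congr M X' M Y" using l1 l2 congr_trans congr_sym by blast
    show "congr X Y' Y' X" by (rule congr_pseudo_refl)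
    show "congr M Y' M X" using l2 l3 congr_trans congr_sym by blast
  qed
  have q: "congr Q X Q' X'"
  proof (rule inner_five_segment[OF bet_sym[OF b(3)] bet_sym[OF b(4)]])
    show "congr Y M Y' M" using l3 congr_both by blast
    show "congr Q M Q' M" using m congr_both congr_sym by blast
    show "congr Y X Y' X'" using d congr_sym congr_right by blast
    show "congr M X M X'" by (rule l1)
  qed
  have "congr P Q P' Q'"
  proof (rule inner_five_segment[OF bet_sym[OF b(1)] bet_sym[OF b(2)]])
    show "congr X M X' M" using l1 congr_both by blast
    show "congr P M P' M" using m congr_both congr_sym by blast
    show "congr X Q X' Q'" using q congr_both by blast
    show "congr M Q M Q'" using m congr_sym by blast
  qed
  then show ?thesis unfolding P'_def Q'_def using congr_sym by blast
qed

definition isometry :: "('a \<Rightarrow> 'a) \<Rightarrow> bool" where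
  "isometry f \<longleftrightarrow> (\<forall>A B. congr (f A) (f B) A B)"

lemma isometryD: "isometry f \<Longrightarrow> congr (f A) (f B) A B"
  unfolding isometry_def by blast

lemma isometry_comp: "isometry f \<Longrightarrow> isometry g \<Longrightarrow> isometry (\<lambda>x. f (g x))"
  unfolding isometry_def using congr_trans by blast

lemma isometry_point_refl: "isometry (point_refl M)"
  unfolding isometry_def using point_refl_isometry by blast

lemma isometry_bet: "isometry f \<Longrightarrow> bet A B C \<Longrightarrow> bet (f A) (f B) (f C)"
  using bet_congr isometryD congr_sym by meson

lemma isometry_col: "isometry f \<Longrightarrow> col A B C \<Longrightarrow> col (f A) (f B) (f C)"
  unfolding col_def using isometry_bet by blast

lemma isometry_congr: "isometry f \<Longrightarrow> congr A B C D \<Longrightarrow> congr (f A) (f B) (f C) (f D)"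
  by (rule congr_trans[OF isometryD congr_trans[OF _ congr_sym[OF isometryD]]])

lemma isometry_midp: "isometry f \<Longrightarrow> midp M A B \<Longrightarrow> midp (f M) (f A) (f B)"
  unfolding midp_def using isometry_bet isometry_congr by blast

lemma isometry_point_refl_conj:
  "isometry f \<Longrightarrow> f (point_refl M A) = point_refl (f M) (f A)"
  using isometry_midp point_refl_midp point_refl_eq by metis

lemma midp_unique: 
  assumes "midp M A B" "midp N A B"
  shows "M = N"
proof (cases "A = B")
  case True
  then show ?thesis using assms by (simp add: midp_same)
next
  case False
  have "point_refl M N = N"
  proof -
    have "congr (point_refl M N) A N B" "congr (point_refl M N) B N A"
      using point_refl_isometry[of M N B] point_refl_isometry[of M N A] 
        point_refl_eq[OF assms(1)] point_refl_eq[OF midp_sym[OF assms(1)]] by auto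
    moreover have "congr N A N B" using midp_congr[OF assms(2)] .
    ultimately have "congr A N A (point_refl M N)" "congr B N B (point_refl M N)"
      by (simp_all add: congr_len len_comm)
    moreover have "col A B N" using assms(2) unfolding midp_def col_def using bet_sym by blast
    ultimately show ?thesis using col_point_unique[OF False] by metis
  qed
  then show ?thesis using point_refl_fixed by metis
qed

lemma col_congr_midp:
  assumes "col A M B" "congr M A M B" "A \<noteq> B"
  shows "midp M A B"
proof -
  have ne: "A \<noteq> M" "B \<noteq> M" using assms congr_null_iff by metis+
  have "\<not> same_ray M A B"
  proof
    assume r: "same_ray M A B"
    then have "bet M A B \<or> bet M B A" unfolding same_ray_def by blast
    then show False
      using congr_sub'[of M A B M A A] congr_sub'[of M B A M B B] assms bet_triv2 
        congr_refl congr_sym congr_null_iff by metis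
  qed
  then have "bet A M B" using same_ray_or_opposite ne assms col_swap by blast
  then show ?thesis unfolding midp_def using assms congr_left by blast
qed

text \<open>
  Prolong the equal sides by equal segments to \<open>P\<close> and \<open>Q\<close>. By symmetry, \<open>AQ\<close> and \<open>BP\<close> meet in a point
  \<open>R\<close> equidistant from \<open>A\<close> and \<open>B\<close>, and \<open>CR\<close> meets \<open>AB\<close> in the midpoint.
\<close>

lemma isosceles_midp:
  assumes CAB: "congr C A C B"
  shows "\<exists>M. midp M A B"
proof (cases "col A B C")
  case True
  then show ?thesis 
    using col_congr_midp[of A C B] CAB col_rot col_swap midp_same by blast
next
  case False
  then have ne: "A \<noteq> B" "A \<noteq> C" "B \<noteq> C" using col_triv by blast+
  obtain P where P: "bet C A P" "A \<noteq> P" using point_beyond by blast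
  obtain Q where Q: "bet C B Q" "congr B Q A P" using segment_construction by blast
  have BQ: "B \<noteq> Q" using P Q congr_null_iff by metis
  obtain R where R: "bet A R Q" "bet B R P"
    using inner_pasch[OF bet_sym[OF P(1)] bet_sym[OF Q(1)]] by blast
  obtain X where X: "bet A X B" "bet R X C"
    using inner_pasch[OF P(1) R(2)] by blast
  have PB: "congr P B Q A"
    using five_segment[OF ne(2)[symmetric] P(1) Q(1) CAB congr_sym[OF Q(2)] congr_sym[OF CAB] congr_pseudo_refl] .
  obtain R' where R': "bet B R' P" "congr A R B R'" "congr R Q R' P"
    using copy_subdivision[OF R(1)] congr_both[OF congr_sym[OF PB]] by blast
  have r1: "congr R B R' A"
    by (rule inner_five_segment[OF R(1) R'(1) congr_both[OF congr_sym[OF PB]] R'(3)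
          congr_pseudo_refl congr_both[OF Q(2)]])
  have r2: "congr R P R' Q"
    by (rule inner_five_segment[OF R(1) R'(1) congr_both[OF congr_sym[OF PB]] R'(3)
          congr_sym[OF Q(2)] congr_pseudo_refl])
  have "bet A R' Q"
    using bet_congr[OF R(2) congr_both[OF r1] r2 congr_both[OF PB]] .
  \<comment> \<open>\<open>R'\<close> is the mirror image of \<open>R\<close>; both lie on \<open>AQ\<close> and \<open>BP\<close>.\<close>
  have "R = R'"
  proof (rule ccontr)
    assume d: "R \<noteq> R'"
    have "col R R' A" "col R R' Q" 
      using R \<open>bet A R' Q\<close> col_of_line[of A Q] bet_col col_triv bet_identity d col_rot col_swap by metis+
    moreover have "col R R' B" "col R R' P" 
      using R R' col_of_line[of B P] bet_col col_triv bet_identity d col_rot col_swap by metis+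
    ultimately have "col A P B" using d col_of_line by blast
    moreover have "col A P C" using P bet_col col_rot by blast
    ultimately show False using False P col_trans_through by blast
  qed
  then have RAB: "congr R A R B" using R' congr_both by blast
  have "R \<noteq> C"
  proof
    assume "R = C"
    then have "col C Q A" "col C Q B" "C \<noteq> Q" using R Q BQ bet_col bet_identity col_rot col_swap by metis+
    then show False using False col_trans_through col_rot by blast
  qed
  then have "congr X A X B"
    using col_equidistant[OF _ _ RAB CAB] X(2) bet_col col_rot col_swap by blast
  then show ?thesis using X midp_def congr_left by blast
qed

text \<open>
  Reflecting the larger isosceles triangle in \<open>C\<close> places it over the smaller one, so that the two
  altitudes from \<open>C\<close> coincide.
\<close>

lemma krippen_aux:
  assumes "bet A1 C A2" "bet B1 C B2" "congr C A1 C B1" "congr C A2 C B2"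
    "midp M1 A1 B1" "midp M2 A2 B2" "seg_le C A1 C A2"
  shows "bet M1 C M2"
proof (cases "A1 = C \<or> A2 = C")
  case True
  show ?thesis
  proof (cases "A1 = C")
    case True
    then show ?thesis using assms congr_null_iff midp_same bet_triv1 by metis
  next
    case False
    then show ?thesis using True assms congr_null_iff midp_same bet_triv2 by metis
  qed
next
  case False
  define A B M where "A = point_refl C A2" and "B = point_refl C B2" and "M = point_refl C M2"
  have M: "midp M A B" unfolding A_def B_def M_def 
    using assms(6) isometry_midp isometry_point_refl by blast
  have CA: "congr C A2 C A" "congr C B2 C B" unfolding A_def B_def
    using point_refl_radius congr_sym by blast+
  have CAB: "congr C A C B" using CA assms(4) congr_trans congr_sym by meson
  have ne: "B2 \<noteq> C" "B1 \<noteq> C" using False assms congr_null_iff by metis+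
  have AA: "A \<noteq> C" "B \<noteq> C" using CA False ne congr_null_iff by metis+
  have "bet A2 C A" "bet B2 C B" unfolding A_def B_def by (rule point_refl_bet)+
  then have "same_ray C A1 A" "same_ray C B1 B"
    using bet_connectivity_from[of A2 C A1 A] bet_connectivity_from[of B2 C B1 B] 
      False ne AA assms bet_sym unfolding same_ray_def by blast+
  moreover have "seg_le C A1 C A" using assms(7) seg_le_congr congr_refl CA by blast
  moreover have "seg_le C B1 C B" 
    using seg_le_congr[OF assms(7,3) congr_trans[OF assms(4) CA(2)]] .
  ultimately have b: "bet C A1 A" "bet C B1 B" using ray_seg_le_bet by blast+
  obtain Q where Q: "bet M Q C" "bet A1 Q B1"
    using pasch_cevian[OF bet_sym[OF b(1)] bet_sym[OF b(2)]] M midp_def by blast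
  have "congr A1 M B1 M"
  proof (rule inner_five_segment[OF bet_sym[OF b(1)] bet_sym[OF b(2)]])
    show "congr A C B C" using CAB by (rule congr_both)
    show "congr A1 C B1 C" using assms(3) by (rule congr_both)
    show "congr A M B M" using M midp_congr congr_both by blast
    show "congr C M C M" by (rule congr_refl)
  qed
  then have MAB: "congr M A1 M B1" using congr_both by blast
  have "congr Q A1 Q B1"
  proof (cases "M = C")
    case True
    then show ?thesis using Q bet_identity MAB by blast
  next
    case False
    then show ?thesis using col_equidistant[OF False _ MAB assms(3)] Q bet_col col_rot col_swap by blast
  qed
  then have "midp Q A1 B1" using Q midp_def congr_left by blast
  then have "Q = M1" using assms(5) midp_unique by blast
  moreover have "bet M2 C M" unfolding M_def by (rule point_refl_bet)
  ultimately show ?thesis using Q bet_inner_trans bet_sym by meson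
qed

text \<open>
  The "crib lemma", which transfers a symmetry at one base of a butterfly to the other base when nothing is
  known yet about reflections in lines.
\<close>

lemma krippen:
  assumes "bet A1 C A2" "bet B1 C B2" "congr C A1 C B1" "congr C A2 C B2"
    "midp M1 A1 B1" "midp M2 A2 B2"
  shows "bet M1 C M2"
  using krippen_aux[OF assms] krippen_aux[OF bet_sym[OF assms(1)] bet_sym[OF assms(2)] assms(4,3,6,5)]
    seg_le_total bet_sym by blast

section \<open>Right angles, feet of perpendiculars, existence of midpoints\<close>

text \<open>
  A right angle at \<open>B\<close>, allowing degenerate sides: the reflection of \<open>A\<close> in \<open>B\<close> is as far from \<open>C\<close> as \<open>A\<close> is.
  Degenerate cases keep the statements about feet of perpendiculars free of case distinctions.
\<close>

definition per :: "'a \<Rightarrow> 'a \<Rightarrow> 'a \<Rightarrow> bool" where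
  "per A B C \<longleftrightarrow> congr C A C (point_refl B A)"

lemma per_triv: "per A B B" "per A A C"
  unfolding per_def using point_refl_radius congr_sym congr_refl by auto

lemma per_sym: "per A B C \<Longrightarrow> per C B A"
  unfolding per_def using point_refl_isometry[of B C "point_refl B A"]
  by (simp add: congr_len len_comm)

lemma per_point_refl: "per A B C \<Longrightarrow> per A B (point_refl B C)"
  unfolding per_def using point_refl_isometry[of B C "point_refl B A"] point_refl_isometry[of B C A]
  by (simp add: congr_len len_comm)

lemma per_col:
  assumes "per A B C" "A \<noteq> B" "col A B A'"
  shows "per A' B C"
proof -
  have "congr A' C (point_refl B A') C"
  proof (rule five_segment_col[OF assms(3,2)])
    show "congr A B (point_refl B A) B" "congr B A' B (point_refl B A')"
      using point_refl_radius congr_sym congr_both by blast+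
    show "congr A A' (point_refl B A) (point_refl B A')"
      using point_refl_isometry congr_sym by blast
    show "congr A C (point_refl B A) C" using assms(1) congr_both unfolding per_def by blast
    show "congr B C B C" by (rule congr_refl)
  qed
  then show ?thesis unfolding per_def by (rule congr_both)
qed

lemma per_not_col:
  assumes "per A B C" "A \<noteq> B" "C \<noteq> B"
  shows "\<not> col A B C"
proof
  assume "col A B C"
  then have "per C B C" using per_col assms by blast
  then show False using assms(3) congr_null_iff point_refl_fixed unfolding per_def by metis
qed

text \<open>
  A triangle has at most one right angle. Otherwise \<open>C\<close> and its reflection in \<open>B\<close> would be equidistant from \<open>A\<close> and
  from the reflection of \<open>A\<close> in \<open>C\<close>, hence also from \<open>C\<close>, which lies between these two.
\<close>

lemma per_unique:
  assumes "per A B C" "per A C B"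
  shows "B = C"
proof (rule ccontr)
  assume ne: "B \<noteq> C"
  define C' where "C' = point_refl B C"
  define A' where "A' = point_refl C A"
  have c: "col B C C'" unfolding C'_def using point_refl_bet bet_col col_rot col_swap by blast
  have 1: "congr A C A C'" using assms(1) per_sym unfolding C'_def per_def by blast
  have "per C' C A" using per_col[OF per_sym[OF assms(2)] ne c] .
  then have 2: "congr C' A C' A'" unfolding A'_def using per_sym per_def by blast
  have 3: "congr C A C A'" unfolding A'_def using point_refl_radius congr_sym by blast
  have 4: "congr A' C A' C'" using 1 2 3 by (simp add: congr_len len_comm)
  have "A \<noteq> C" 
  proof
    assume "A = C"
    then have "C' = C" using 1 congr_null_iff by blast
    then show False using ne point_refl_fixed unfolding C'_def by metis
  qed
  then have "A' \<noteq> A" using point_refl_fixed unfolding A'_def by metis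
  moreover have "col A A' C" unfolding A'_def using point_refl_bet bet_col col_rot col_swap by blast
  ultimately have "congr C C C C'" using col_equidistant[of A A' C C C'] 1 4 by blast
  then have "C' = C" using congr_null_iff by blast
  then show False using ne point_refl_fixed unfolding C'_def by metis
qed

text \<open>
  Here the dimension is used: two perpendiculars to a line in the same point coincide.
\<close>

lemma per_same_foot_col:
  assumes "per A M D" "per A M Y" "A \<noteq> M"
  shows "col D Y M"
proof -
  have "A \<noteq> point_refl M A" using assms(3) point_refl_fixed by metis
  then show ?thesis
    using upper_dimension[of A "point_refl M A" D Y M] assms point_refl_radius congr_sym
    unfolding per_def col_def by blast
qed

definition is_foot :: "'a \<Rightarrow> 'a \<Rightarrow> 'a \<Rightarrow> 'a \<Rightarrow> bool" where
  "is_foot A B X M \<longleftrightarrow> col A B M \<and> (\<forall>U. col A B U \<longrightarrow> per U M X)"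

lemma is_footI:
  assumes "A \<noteq> B" "col A B M" "col A B U" "U \<noteq> M" "per U M X"
  shows "is_foot A B X M"
  unfolding is_foot_def using per_col[OF assms(5,4)] col_of_line[OF assms(1) assms(3,2)] assms(2) 
  by blast

lemma is_foot_unique: "is_foot A B X M \<Longrightarrow> is_foot A B X N \<Longrightarrow> M = N"
  unfolding is_foot_def by (rule per_unique[of X]) (blast intro: per_sym)+

text \<open>
  A circle about \<open>X\<close> that contains \<open>A\<close> in its interior cuts the line in two points, and the
  midpoint of this chord is the foot.
\<close>

lemma is_foot_exists:
  assumes AB: "A \<noteq> B"
  shows "\<exists>M. is_foot A B X M"
proof (cases "col A B X")
  case True
  then show ?thesis unfolding is_foot_def using per_triv by blast
next
  case False
  obtain R where R: "bet X A R" "A \<noteq> R" using point_beyond by blast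
  obtain Y Z where Y: "Y \<noteq> Z" "congr X Y X R" "congr X Z X R" "col A B Y" "col A B Z"
    using line_circle[OF AB _ R congr_refl] bet_triv2 unfolding col_def by metis
  have YZ: "congr X Y X Z" using Y congr_trans congr_sym by blast
  then obtain M where M: "midp M Y Z" using isosceles_midp by blast
  have "col A B M" using line_change[OF Y(1,4,5) _ AB] M midp_def bet_col col_rot col_swap by metis
  moreover have "Y \<noteq> M" using M Y(1) midp_start by blast
  moreover have "per Y M X" unfolding per_def using YZ point_refl_eq[OF M] by simp
  ultimately show ?thesis using is_footI AB Y by blast
qed

lemma exists_not_col:
  assumes "A \<noteq> B"
  shows "\<exists>C. \<not> col A B C"
  using lower_dimension col_of_line[OF assms] unfolding col_def by blast

lemma per_midpoints:
  assumes ABC: "per A B C" and P: "midp P C' D" and A: "midp A C' C" and B: "midp B D C"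
    and AB: "A \<noteq> B"
  shows "per B A P"
proof -
  define B' where "B' = point_refl A B"
  have SC: "point_refl A C = C'" using A midp_sym point_refl_eq by blast
  have "col A B B'" unfolding B'_def using point_refl_bet bet_col col_rot col_swap by blast
  then have "per B' B C" using per_col ABC AB by blast
  then have 1: "congr B' C B' D"
    using per_sym per_def point_refl_eq[OF midp_sym[OF B]] by metis
  have "congr P B P B'"
  proof (rule inner_five_segment)
    show "bet C' P D" "bet D P C'" using P midp_def bet_sym by blast+
    show "congr C' D D C'" by (rule congr_pseudo_refl)
    show "congr P D P C'" using P midp_congr congr_sym by blast
    have "congr C' B C B'" unfolding B'_def using point_refl_isometry[of A C "point_refl A B"] SC by simp
    then show "congr C' B D B'" using 1 by (simp add: congr_len len_comm)
    have "congr C' B' C B" unfolding B'_def using point_refl_isometry[of A C B] SC by simp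
    then show "congr D B C' B'" using midp_congr[OF B] by (simp add: congr_len len_comm)
  qed
  then show ?thesis unfolding per_def B'_def .
qed

text \<open>
  If the foot \<open>X\<close> of \<open>C\<close> is not already \<open>A\<close>, the reflections \<open>Y\<close> and \<open>D\<close> of \<open>C\<close> in \<open>A\<close> and in \<open>X\<close> are
  equidistant from \<open>A\<close>; the altitude of the isosceles triangle \<open>YAD\<close> is the perpendicular. The intersection
  \<open>T\<close> records that \<open>P\<close> and \<open>C\<close> are on different sides of \<open>AB\<close>.
\<close>

lemma perpendicular_at:
  assumes AB: "A \<noteq> B" and C: "\<not> col A B C"
  shows "\<exists>P T. per B A P \<and> P \<noteq> A \<and> col A B T \<and> bet C T P"
proof -
  obtain X where X: "is_foot A B C X" using is_foot_exists AB by blast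
  show ?thesis
  proof (cases "X = A")
    case True
    have "per B A (point_refl A C)" 
      using X True per_point_refl col_triv unfolding is_foot_def by blast
    moreover have "point_refl A C \<noteq> A" using C col_triv point_refl_invol point_refl_centre by metis
    ultimately show ?thesis using point_refl_bet col_triv by blast
  next
    case False
    define D where "D = point_refl X C"
    define Y where "Y = point_refl A C"
    have Xc: "col A B X" using X is_foot_def by blast
    have pX: "per A X C" "per B X C" using X col_triv unfolding is_foot_def by blast+
    then have "congr A C A D" unfolding D_def using per_sym per_def by blast
    then have "congr A Y A D" unfolding Y_def using point_refl_radius congr_trans by blast
    then obtain P where P: "midp P Y D" using isosceles_midp by blast
    have AX: "A \<noteq> X" using False by blast
    have m: "midp A Y C" "midp X D C" unfolding Y_def D_def using point_refl_midp midp_sym by blast+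
    have "per X A P" using per_midpoints[OF pX(1) P m AX] .
    then have "per B A P" using per_col AX Xc col_rot col_swap by blast
    moreover have "P \<noteq> A"
    proof
      assume "P = A"
      then have "C = D" using P m midp_exists_unique by blast
      then have "C = X" unfolding D_def using point_refl_fixed by metis
      then show False using C Xc by blast
    qed
    moreover obtain T where T: "bet P T C" "bet X T A"
      using pasch_cevian m P bet_sym unfolding midp_def by metis
    moreover have "col A B T" 
      using T Xc AX AB line_change[of A X A B T] col_triv bet_col col_rot col_swap by meson
    ultimately show ?thesis using bet_sym by blast
  qed
qed

text \<open>
  Equal perpendiculars \<open>AP\<close> and \<open>BR\<close> on different sides of \<open>AB\<close> are opposite sides of a
  parallelogram with diagonals \<open>AB\<close> and \<open>PR\<close>. They meet at \<open>X\<close>, and the crib lemma for the reflections \<open>P'\<close>, \<open>R'\<close> of \<open>P\<close>, \<open>R\<close>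
  shows that the remaining sides \<open>AR\<close> and \<open>BP\<close> are congruent as well.
\<close>

lemma midp_exists_aux:
  assumes AB: "A \<noteq> B" and P: "per B A P" "P \<noteq> A" and Q: "per A B Q" "Q \<noteq> B"
    and T: "col A B T" "bet P T Q" and le: "seg_le A P B Q"
  shows "\<exists>M. midp M A B"
proof -
  obtain R where R: "bet B R Q" "congr A P B R" using le seg_le_def by blast
  have RB: "R \<noteq> B" using R P congr_null_iff by blast
  have pR: "per A B R" 
    using per_sym[OF per_col[OF per_sym[OF Q(1)] Q(2)]] R bet_col col_rot col_swap by meson
  obtain X where X: "bet T X B" "bet R X P" using inner_pasch[OF T(2) R(1)] by blast
  have XAB: "col A B X"
  proof (cases "T = B")
    case True then show ?thesis using X bet_identity col_triv by blast
  next
    case False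
    then show ?thesis using line_change[of T B A B X] T X AB col_triv bet_col col_rot col_swap by metis
  qed
  have Pn: "\<not> col A B P" using per_not_col P AB col_swap by metis
  have pXA: "per X A P" using per_col P AB XAB col_swap by metis
  define P' where "P' = point_refl A P"
  have XP: "congr X P X P'" using per_sym[OF pXA] unfolding per_def P'_def .
  obtain R' where R': "bet P' X R'" "congr X R' X R" using segment_construction by blast
  obtain M where M: "midp M R R'" using isosceles_midp R' congr_sym by blast
  have bA: "bet A X M"
    using krippen[OF bet_sym[OF X(2)] R'(1) XP congr_sym[OF R'(2)] _ M] point_refl_midp P'_def by blast
  have XA: "X \<noteq> A"
  proof
    assume "X = A"
    then have "col P A R" using X bet_col col_rot col_swap by blast
    then have "per R A B" using per_col per_sym P by blast
    then show False using per_unique per_sym[OF pR] AB by blast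
  qed
  \<comment> \<open>both are the foot of the perpendicular from \<open>R\<close>\<close>
  have "M = B"
  proof -
    have cM: "col A B M" using line_change[of A X A B M] XA bA XAB AB col_triv bet_col by metis
    have XM: "X \<noteq> M"
    proof
      assume e: "X = M"
      have "R \<noteq> X" using e M R' per_not_col[OF pR AB RB] XAB by blast
      moreover have "R' \<noteq> X" using calculation R' congr_null_iff by blast
      moreover have "col R X R'" using M e bet_col unfolding midp_def by blast
      moreover have "col R X P" "col X R' P'" using X R' bet_col col_rot col_swap by blast+
      ultimately have "col X P P'" 
        using col_trans_through[of X R R' P'] col_trans_through[of X R P R'] 
          line_change[of X R' X R P'] col_of_line[of X R X P P'] col_triv col_rot col_swap by metis
      moreover have "P \<noteq> P'" unfolding P'_def using P point_refl_fixed by metis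
      moreover have "col P P' A" unfolding P'_def using point_refl_bet bet_col col_rot col_swap by blast
      ultimately have "col A X P" using col_of_line[of P P' A X P] col_triv col_rot col_swap by blast
      then show False using Pn XA XAB line_change[of A X A B P] AB col_triv by metis
    qed
    have "per R M X" unfolding per_def point_refl_eq[OF M] using R' congr_sym by blast
    then have "is_foot A B R M" using is_footI[OF AB cM XAB XM] per_sym by blast
    moreover have "is_foot A B R B" using is_footI[OF AB _ _ AB pR] col_triv by blast
    ultimately show ?thesis using is_foot_unique by blast
  qed
  then have BR: "midp B R R'" using M by blast
  have AP: "midp A P P'" unfolding P'_def by (rule point_refl_midp)
  have PX: "P \<noteq> X" using Pn XAB by blast
  have RP: "congr R P' R' P"
    using five_segment[OF PX bet_sym[OF X(2)] R'(1) congr_both[OF XP] congr_sym[OF R'(2)] 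
        congr_pseudo_refl congr_sym[OF XP]] .
  have ll: "len R B = len A P" "len R' B = len A P" "len P' A = len A P"
    using R(2) midp_congr[OF BR] midp_congr[OF AP] by (simp_all add: congr_len len_comm)
  have b: "bet R' B R" "bet P' A P" using BR AP midp_sym midp_def by blast+
  have BP: "congr B P A R"
  proof (rule inner_five_segment[OF b])
    show "congr R' R P' P" 
      by (rule congr_add[OF b]) (use ll in \<open>simp_all add: congr_len len_comm\<close>)
    show "congr B R A P" using ll by (simp add: congr_len len_comm)
    show "congr R' P P' R" using RP by (simp add: congr_len len_comm)
    show "congr R P P R" by (rule congr_pseudo_refl)
  qed
  \<comment> \<open>\<open>X'\<close> divides \<open>PR\<close> as \<open>X\<close> divides \<open>RP\<close>; it turns out to be \<open>X\<close> itself.\<close>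
  obtain X' where X': "bet P X' R" "congr R X P X'" "congr X P X' R"
    using copy_subdivision[OF X(2) congr_pseudo_refl] by blast
  have e1: "congr X A X' B"
    by (rule inner_five_segment[OF X(2) X'(1) congr_pseudo_refl X'(3)])
       (use BP ll in \<open>simp_all add: congr_len len_comm\<close>)
  have e2: "congr X B X' A"
    by (rule inner_five_segment[OF X(2) X'(1) congr_pseudo_refl X'(3)])
       (use BP ll in \<open>simp_all add: congr_len len_comm\<close>)
  have "col B X' A"
    using col_congr[of A X B B X' A] XAB e1 e2 congr_pseudo_refl col_rot col_swap congr_both by meson
  then have "col A B X'" using col_rot by blast
  moreover have "col P R X" "col P R X'" using X X' bet_col col_rot col_swap by blast+
  moreover have "P \<noteq> R" using X bet_identity PX by blast
  ultimately have "X = X'" using line_change[of X X' A B P] col_of_line[of P R X X' P] 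
      Pn XAB AB col_triv by metis
  then have "congr X A X B" using e1 by blast
  then show ?thesis using col_congr_midp XAB AB col_rot col_swap by blast
qed

lemma midp_exists: "\<exists>M. midp M A B"
proof (cases "A = B")
  case True
  then show ?thesis using midp_same by blast
next
  case False
  obtain C where C: "\<not> col B A C" using exists_not_col False by metis
  obtain Q where Q: "per A B Q" "Q \<noteq> B" using perpendicular_at[OF False[symmetric] C] by blast
  have "\<not> col A B Q" using per_not_col Q False by blast
  then obtain P T where P: "per B A P" "P \<noteq> A" "col A B T" "bet Q T P"
    using perpendicular_at[OF False] by blast
  show ?thesis
    using seg_le_total[of A P B Q] midp_exists_aux[OF False P(1,2) Q P(3) bet_sym[OF P(4)]]
      midp_exists_aux[OF False[symmetric] Q P(1,2) col_swap[OF P(3)] P(4)] midp_sym by blast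
qed

definition mid :: "'a \<Rightarrow> 'a \<Rightarrow> 'a" where
  "mid A B = (THE M. midp M A B)"

lemma mid_midp: "midp (mid A B) A B"
  unfolding mid_def using theI'[of "\<lambda>M. midp M A B"] midp_exists midp_unique by blast

lemma mid_eq: "midp M A B \<Longrightarrow> mid A B = M"
  using mid_midp midp_unique by blast

lemma mid_comm: "mid A B = mid B A"
  using mid_midp mid_eq midp_sym by blast

lemma point_refl_mid [simp]: "point_refl (mid A B) A = B" "point_refl (mid A B) B = A"
  using point_refl_eq mid_midp midp_sym by blast+

lemma isometry_mid: "isometry f \<Longrightarrow> f (mid A B) = mid (f A) (f B)"
  using isometry_midp mid_midp mid_eq by metis

section \<open>The two sides of a line and Pasch's axiom\<close>

definition opposite_sides :: "'a \<Rightarrow> 'a \<Rightarrow> 'a \<Rightarrow> 'a \<Rightarrow> bool" where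
  "opposite_sides A B X Y \<longleftrightarrow> \<not> col A B X \<and> \<not> col A B Y \<and> (\<exists>T. col A B T \<and> bet X T Y)"

lemma opposite_sides_sym: "opposite_sides A B X Y \<Longrightarrow> opposite_sides A B Y X"
  unfolding opposite_sides_def using bet_sym by blast

text \<open>
  The case in which the crossing \<open>N\<close> with the side \<open>DC\<close> lies between the two other crossings.
\<close>

lemma no_line_crosses_three_sides_aux:
  assumes AB: "A \<noteq> B" and X: "\<not> col A B X" and D: "\<not> col A B D" and C: "\<not> col A B C"
    and M: "col A B M" "bet X M D" and N: "col A B N" "bet D N C" and T: "col A B T" "bet X T C"
    and MNT: "bet M N T"
  shows False
proof -
  obtain Y where Y: "bet N Y X" "bet T Y D" using inner_pasch[OF N(2) T(2)] by blast
  obtain W where W: "bet M W T" "bet Y W X" using inner_pasch[OF M(2) Y(2)] by blast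
  have Wl: "col A B W" 
  proof (cases "M = T")
    case True then show ?thesis using W bet_identity M by blast
  next
    case False 
    then show ?thesis using line_change[OF False M(1) T(1) _ AB] W bet_col col_rot col_swap by blast
  qed
  have "W = N"
  proof (rule ccontr)
    assume "W \<noteq> N"
    moreover have "bet N W X" using Y W bet_exchange2 by blast
    ultimately have "col A B X" using line_change[of N W A B X] N Wl AB bet_col by blast
    then show False using X by blast
  qed
  then have "Y = N" using W Y bet_antisym by blast
  then have TN: "bet T N D" using Y by blast
  have eq: "T = N"
  proof (rule ccontr)
    assume "T \<noteq> N"
    then have "col A B D" using line_change[of T N A B D] TN N T AB bet_col by blast
    then show False using D by blast
  qed
  have TC: "C \<noteq> T" using C T by blast
  have "bet T X D \<or> bet T D X"
    using bet_connectivity_from[OF TC bet_sym[OF T(2)]] bet_sym N eq by blast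
  then have "bet T X M \<or> bet T D M" using M(2) bet_inner_trans bet_sym by blast
  moreover have "\<not> bet T X M" if "\<not> col A B X" for X
  proof
    assume b: "bet T X M"
    show False
    proof (cases "T = M")
      case True then show False using b bet_identity that T by blast
    next
      case False 
      then show False using line_change[OF False T(1) M(1) _ AB] b bet_col col_rot col_swap that by blast
    qed
  qed
  ultimately show False using X D by blast
qed

text \<open>
  If a line crossed all three sides of a triangle, one of the three crossings would lie between the others, inside
  the triangle and on a side of it; inner Pasch excludes this.
\<close>

lemma no_line_crosses_three_sides:
  assumes AB: "A \<noteq> B" and "opposite_sides A B X D" "opposite_sides A B D C" 
  shows "\<not> opposite_sides A B X C"
proof
  assume XC: "opposite_sides A B X C"
  have n: "\<not> col A B X" "\<not> col A B D" "\<not> col A B C" using assms unfolding opposite_sides_def by blast+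
  obtain M where M: "col A B M" "bet X M D" using assms unfolding opposite_sides_def by blast
  obtain N where N: "col A B N" "bet D N C" using assms unfolding opposite_sides_def by blast
  obtain T where T: "col A B T" "bet X T C" using XC unfolding opposite_sides_def by blast
  have "col M N T" using col_of_line AB M N T by blast
  then consider "bet M N T" | "bet N T M" | "bet T M N" unfolding col_def by blast
  then show False
  proof cases
    case 1 then show False using no_line_crosses_three_sides_aux[OF AB n M N T] by blast
  next
    case 2 
    show False 
      using no_line_crosses_three_sides_aux[OF AB n(2,3,1) N T(1) bet_sym[OF T(2)] M(1) bet_sym[OF M(2)] 2] .
  next
    case 3
    show False 
      using no_line_crosses_three_sides_aux[OF AB n(3,1,2) T(1) bet_sym[OF T(2)] M N(1) bet_sym[OF N(2)] 3] .
  qed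
qed

lemma line_point_refl:
  assumes "A \<noteq> B" "col A B M" "col A B U"
  shows "col A B (point_refl M U)"
proof (cases "U = M")
  case True then show ?thesis using assms by simp
next
  case False
  then show ?thesis 
    using line_change[OF False assms(3,2) _ assms(1)] point_refl_bet bet_col by blast
qed

lemma line_mid:
  assumes "A \<noteq> B" "col A B U" "col A B V"
  shows "col A B (mid U V)"
proof (cases "U = V")
  case True then show ?thesis using assms mid_eq midp_same by metis
next
  case False
  then show ?thesis 
    using line_change[OF False assms(2,3) _ assms(1)] mid_midp midp_def bet_col col_rot col_swap by metis
qed

lemma isometry_per: "isometry f \<Longrightarrow> per A B C \<Longrightarrow> per (f A) (f B) (f C)"
  unfolding per_def using isometry_congr isometry_point_refl_conj by metis

text \<open>
  The segment from \<open>X\<close> to its reflection in a point of the line crosses the line, and still does after one end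
  is moved along a ray from a point of the line. If it moves outwards, reflecting in \<open>M\<close>
  turns this into moving the other end inwards, so inner Pasch is enough in both cases.
\<close>

lemma opposite_sides_of_ray:
  assumes AB: "A \<noteq> B" and X: "\<not> col A B X" and Y: "\<not> col A B Y"
    and M: "col A B M" and Y0: "col A B Y0" and r: "same_ray Y0 (point_refl M X) Y"
  shows "opposite_sides A B X Y"
proof -
  define D where "D = point_refl M X"
  have XMD: "bet X M D" unfolding D_def by (rule point_refl_bet)
  consider "bet Y0 Y D" | "bet Y0 D Y" using r unfolding same_ray_def D_def by blast
  then show ?thesis
  proof cases
    case 1
    obtain Z where Z: "bet Y Z X" "bet M Z Y0" using inner_pasch[OF 1 XMD] by blast
    have "col A B Z"
    proof (cases "M = Y0")
      case True then show ?thesis using Z bet_identity M by blast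
    next
      case False 
      then show ?thesis using line_change[OF False M Y0 _ AB] Z bet_col col_rot col_swap by blast
    qed
    then show ?thesis unfolding opposite_sides_def using X Y Z bet_sym by blast
  next
    case 2
    define X0 where "X0 = point_refl M Y0"
    have X0: "col A B X0" unfolding X0_def using line_point_refl AB M Y0 by blast
    have "bet X0 X (point_refl M Y)"
      using isometry_bet[OF isometry_point_refl 2, of M] unfolding X0_def D_def by simp
    then obtain Z where Z: "bet X Z Y" "bet M Z X0" using inner_pasch[OF _ point_refl_bet] by blast
    have "col A B Z"
    proof (cases "M = X0")
      case True then show ?thesis using Z bet_identity M by blast
    next
      case False 
      then show ?thesis using line_change[OF False M X0 _ AB] Z bet_col col_rot col_swap by blast
    qed
    then show ?thesis unfolding opposite_sides_def using X Y Z by blast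
  qed
qed

text \<open>
  Reflecting \<open>X\<close> in the midpoint of the two feet gives a point \<open>D\<close> on the perpendicular through \<open>Y\<close>. So \<open>D\<close> is on the
  ray of \<open>Y\<close> or on that of the mirror image of \<open>Y\<close>.
\<close>

lemma opposite_sides_dichotomy:
  assumes AB: "A \<noteq> B" and X: "\<not> col A B X" and Y: "\<not> col A B Y" and Y0: "is_foot A B Y Y0"
  shows "opposite_sides A B X Y \<or> opposite_sides A B X (point_refl Y0 Y)"
proof -
  obtain X0 where X0: "is_foot A B X X0" using is_foot_exists AB by blast
  have l: "col A B X0" "col A B Y0" using X0 Y0 is_foot_def by blast+
  define M where "M = mid X0 Y0"
  have M: "col A B M" unfolding M_def using line_mid AB l by blast
  define D where "D = point_refl M X"
  obtain U where U: "col A B U" "U \<noteq> Y0" using AB col_triv by metis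
  have "per (point_refl M U) X0 X" using X0 line_point_refl[OF AB M U(1)] is_foot_def by blast
  then have pD: "per U Y0 D" 
    using isometry_per[OF isometry_point_refl, of "point_refl M U" X0 X M] unfolding D_def M_def by simp
  have "per U Y0 Y" using Y0 U is_foot_def by blast
  then have c: "col Y0 D Y" using per_same_foot_col pD U(2) col_rot col_swap by blast
  have ne: "D \<noteq> Y0" "Y \<noteq> Y0" 
    using X Y l point_refl_invol[of M X] unfolding D_def M_def by (metis point_refl_mid(2), blast)
  show ?thesis
  proof (cases "same_ray Y0 D Y")
    case True
    then show ?thesis using opposite_sides_of_ray[OF AB X Y M l(2)] unfolding D_def by blast
  next
    case False
    define Y' where "Y' = point_refl Y0 Y"
    have b: "bet Y Y0 D" using False same_ray_or_opposite[OF c ne] bet_sym by blast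
    have Y': "bet Y Y0 Y'" unfolding Y'_def by (rule point_refl_bet)
    have "Y' \<noteq> Y0" using ne unfolding Y'_def by (metis point_refl_invol point_refl_centre)
    then have r: "same_ray Y0 D Y'" 
      unfolding same_ray_def using bet_connectivity_from[OF ne(2) b Y'] ne by blast
    have "\<not> col A B Y'" using line_point_refl[OF AB l(2), of Y'] Y unfolding Y'_def by auto
    then show ?thesis using opposite_sides_of_ray[OF AB X _ M l(2)] r unfolding D_def Y'_def by blast
  qed
qed

text \<open>
  Pasch's axiom. If \<open>X\<close> and \<open>C\<close> were both on the side of \<open>P\<close>, they would be opposite to the mirror image of
  \<open>P\<close>, and the line would cross all sides of the triangle formed by the three.
\<close>

lemma pasch:
  assumes AB: "A \<noteq> B" and XC: "opposite_sides A B X C" and P: "\<not> col A B P"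
  shows "opposite_sides A B P X \<or> opposite_sides A B P C"
proof (rule ccontr)
  assume neg: "\<not> ?thesis"
  obtain P0 where P0: "is_foot A B P P0" using is_foot_exists AB by blast
  have "opposite_sides A B X (point_refl P0 P)" "opposite_sides A B C (point_refl P0 P)"
    using opposite_sides_dichotomy[OF AB _ P P0, of X] opposite_sides_dichotomy[OF AB _ P P0, of C] neg opposite_sides_sym XC 
    unfolding opposite_sides_def by blast+
  then show False using no_line_crosses_three_sides[OF AB] XC opposite_sides_sym by blast
qed

section \<open>Playfair's axiom and parallel lines\<close>

definition line :: "'a \<Rightarrow> 'a \<Rightarrow> 'a set" where
  "line A B = {Z. col A B Z}"

lemma line_mem [simp]: "A \<in> line A B" "B \<in> line A B"
  unfolding line_def using col_triv by auto

lemma line_eq: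
  assumes "A \<noteq> B" "P \<noteq> Q" "P \<in> line A B" "Q \<in> line A B"
  shows "line P Q = line A B"
proof -
  have "col A B P" "col A B Q" using assms unfolding line_def by auto
  then show ?thesis unfolding line_def
    using line_change[OF assms(2) _ _ _ assms(1)] col_of_line[OF assms(1)] by blast
qed

lemma line_eq_start:
  assumes "P \<noteq> Q" "Q' \<noteq> P" "Q' \<in> line P Q"
  shows "line P Q' = line P Q"
  using line_eq[OF assms(1) assms(2)[symmetric] _ assms(3)] by simp

text \<open>
  The two parallels through \<open>P\<close> bound an angle that contains \<open>T\<close>. Euclid's axiom yields points \<open>X\<close>, \<open>Y\<close> on
  its sides with \<open>T\<close> between them; the line \<open>UV\<close> then enters the triangle \<open>PXY\<close> at \<open>T\<close> and can leave it only
  through one of the parallels. If instead \<open>T\<close> comes before \<open>D\<close>, the triangles \<open>PDB\<close> and \<open>PDC\<close> play this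
  role.
\<close>

lemma playfair_aux:
  assumes UV: "U \<noteq> V" and PB: "P \<noteq> B" and PC: "P \<noteq> C" 
    and dB: "line P B \<inter> line U V = {}" and dC: "line P C \<inter> line U V = {}"
    and T: "T \<in> line U V" and D: "bet B D C" "bet P D T \<or> bet P T D" "D \<noteq> P"
  shows False
proof -
  have off: "\<not> col U V Z" if "Z \<in> line P B \<or> Z \<in> line P C" for Z
    using that dB dC unfolding line_def by blast
  have Tl: "col U V T" using T unfolding line_def by blast
  have Pl: "\<not> col U V P" using off by simp
  have same: "\<not> opposite_sides U V P X" if "X \<in> line P B \<or> X \<in> line P C" for X
  proof
    assume "opposite_sides U V P X"
    then obtain Z where Z: "col U V Z" "bet P Z X" unfolding opposite_sides_def by blast
    have "P \<noteq> X" using Z Pl bet_identity by blast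
    then have "line P X = line P B \<or> line P X = line P C" 
      using line_eq_start PB PC that by metis
    moreover have "Z \<in> line P X" unfolding line_def using Z bet_col col_rot col_swap by blast
    ultimately show False using off Z by blast
  qed
  show False
  proof (cases "bet P D T")
    case True
    obtain X Y where X: "bet P B X" and Y: "bet P C Y" and XY: "bet X T Y"
      using euclid[OF True D(1) D(3)[symmetric]] by blast
    have l: "X \<in> line P B" "Y \<in> line P C" unfolding line_def using X Y bet_col by blast+
    then have "opposite_sides U V X Y" unfolding opposite_sides_def using off Tl XY by blast
    then show False using pasch[OF UV _ Pl] same l by blast
  next
    case False
    then have b: "bet P T D" and TD: "T \<noteq> D" using D bet_triv2 by blast+
    have Dl: "\<not> col U V D"
    proof
      assume "col U V D"
      then have "col U V P" using line_change[OF TD Tl _ _ UV] b bet_col col_rot by blast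
      then show False using Pl by blast
    qed
    have PD: "opposite_sides U V P D" unfolding opposite_sides_def using Pl Dl Tl b by blast
    have "opposite_sides U V B D" "opposite_sides U V C D" 
      using pasch[OF UV PD, of B] pasch[OF UV PD, of C] off same opposite_sides_sym line_mem by metis+
    then obtain Z1 Z2 where Z: "col U V Z1" "col U V Z2" "bet B Z1 D" "bet C Z2 D"
      unfolding opposite_sides_def by blast
    have "bet Z1 D C" using Z D bet_exchange3 by blast
    then have b: "bet Z1 D Z2" using Z bet_sym bet_inner_trans by blast
    show False
    proof (cases "Z1 = Z2")
      case True then show False using b bet_identity Dl Z by blast
    next
      case False
      then show False using line_change[OF False Z(1,2) _ UV] b Dl bet_col col_rot col_swap by blast
    qed
  qed
qed

text \<open>
  It has to be arranged that \<open>T = U\<close> lies in the angle between the parallels: by Pasch, the line \<open>PU\<close> meets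
  \<open>BC\<close> or \<open>B'C\<close> for the reflection \<open>B'\<close> of \<open>B\<close> in \<open>P\<close>, and a reflection in \<open>P\<close> corrects the
  direction if necessary.
\<close>

lemma playfair_from_point:
  assumes UV: "U \<noteq> V" and PB: "P \<noteq> B" and PC: "P \<noteq> C" 
    and dB: "line P B \<inter> line U V = {}" and dC: "line P C \<inter> line U V = {}"
  shows "col P B C"
proof (rule ccontr)
  assume n: "\<not> col P B C"
  have PT: "P \<noteq> U" using dB line_mem by blast
  have nB: "\<not> col P U B" using dB col_rot col_swap line_mem unfolding line_def by blast
  have nC: "\<not> col P U C" using dC col_rot col_swap line_mem unfolding line_def by blast
  have refl: "line P (point_refl P X) = line P X \<and> point_refl P X \<noteq> P" if "X \<noteq> P" for X
    using line_eq_start[of P X "point_refl P X"] that point_refl_bet bet_col col_swap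
      point_refl_invol point_refl_centre unfolding line_def by (metis mem_Collect_eq)
  define B' where "B' = point_refl P B"
  have "\<not> col P U B'" using line_point_refl[OF PT, of P B'] nB col_triv unfolding B'_def by auto
  then have "opposite_sides P U B B'" unfolding opposite_sides_def using nB point_refl_bet col_triv B'_def by blast
  then have "opposite_sides P U C B \<or> opposite_sides P U C B'" using pasch[OF PT _ nC] by blast
  then obtain E D where E: "E = B \<or> E = B'" and D: "bet E D C" "col P U D"
    unfolding opposite_sides_def using bet_sym by blast
  have lE: "line P E = line P B" "E \<noteq> P" using E refl PB unfolding B'_def by metis+
  have DP: "D \<noteq> P"
  proof
    assume "D = P"
    then have "C \<in> line P E" using D bet_col col_swap unfolding line_def by blast
    then show False using n lE unfolding line_def by blast
  qed
  consider "bet P D U \<or> bet P U D" | "bet D P U" using D(2) unfolding col_def using bet_sym by blast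
  then show False
  proof cases
    case 1
    show False using playfair_aux[OF UV lE(2)[symmetric] PC _ dC _ D(1) 1 DP] lE dB by simp
  next
    case 2
    define D' where "D' = point_refl P D"
    have b: "bet (point_refl P E) D' (point_refl P C)" 
      unfolding D'_def using isometry_bet[OF isometry_point_refl D(1)] .
    have "bet D P D'" unfolding D'_def by (rule point_refl_bet)
    then have c: "bet P D' U \<or> bet P U D'" using bet_connectivity_from[OF DP 2] by blast
    show False 
      using playfair_aux[OF UV _ _ _ _ _ b c, unfolded D'_def] refl[of E] refl[of C] refl[of D] 
        lE DP PC dB dC by (metis line_mem(1))
  qed
qed

lemma playfair:
  assumes "A \<noteq> B" "C \<noteq> D" "U \<noteq> V" "P \<in> line A B" "P \<in> line C D"
    "line A B \<inter> line U V = {}" "line C D \<inter> line U V = {}"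
  shows "line A B = line C D"
proof -
  obtain B' where B': "B' \<in> line A B" "P \<noteq> B'" using assms(1) line_mem by metis
  obtain C' where C': "C' \<in> line C D" "P \<noteq> C'" using assms(2) line_mem by metis
  have l: "line P B' = line A B" "line P C' = line C D" using line_eq B' C' assms by metis+
  have "col P B' C'" using playfair_from_point[OF assms(3) B'(2) C'(2)] l assms(6,7) by blast
  then have "C' \<in> line P B'" unfolding line_def by blast
  then show ?thesis using l line_eq_start B' C' by metis
qed

text \<open>
  Parallel or equal, which is an equivalence relation between lines.
\<close>

definition par :: "'a \<Rightarrow> 'a \<Rightarrow> 'a \<Rightarrow> 'a \<Rightarrow> bool" where
  "par A B C D \<longleftrightarrow> A \<noteq> B \<and> C \<noteq> D \<and> (line A B = line C D \<or> line A B \<inter> line C D = {})"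

lemma par_sym: "par A B C D \<Longrightarrow> par C D A B"
  unfolding par_def by blast

lemma par_trans:
  assumes "par A B C D" "par C D E F"
  shows "par A B E F"
proof (cases "line A B \<inter> line E F = {}")
  case True then show ?thesis using assms unfolding par_def by blast
next
  case False
  then obtain P where "P \<in> line A B" "P \<in> line E F" by blast
  then have "line A B = line E F"
    using playfair[of A B E F C D P] assms unfolding par_def by blast
  then show ?thesis using assms unfolding par_def by blast
qed

lemma par_point_refl:
  assumes "A \<noteq> B"
  shows "par A B (point_refl M A) (point_refl M B)"
proof -
  have ne: "point_refl M A \<noteq> point_refl M B" using assms point_refl_invol by metis
  show ?thesis
  proof (cases "col A B M")
    case True
    then have "line (point_refl M A) (point_refl M B) = line A B"
      using line_eq[OF assms ne] line_point_refl[OF assms True] col_triv unfolding line_def by blast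
    then show ?thesis unfolding par_def using assms ne by blast
  next
    case False
    have "False" if Z: "Z \<in> line A B" "Z \<in> line (point_refl M A) (point_refl M B)" for Z
    proof -
      have "col A B (point_refl M Z)"
        using isometry_col[OF isometry_point_refl, of _ _ Z M] Z unfolding line_def by fastforce
      moreover have "Z \<noteq> M" using False Z unfolding line_def by blast
      moreover have "mid Z (point_refl M Z) = M" using mid_eq point_refl_midp by blast
      ultimately have "col A B M" using line_mid[OF assms, of Z "point_refl M Z"] Z unfolding line_def by simp
      then show False using False by blast
    qed
    then show ?thesis unfolding par_def using assms ne by blast
  qed
qed

lemma mid_cancel: "mid x y = mid x' y \<Longrightarrow> x = x'"
  using point_refl_mid(2) by metis

section \<open>Products of point reflections\<close>

text \<open>
  Each point goes to itself or to its reflection in \<open>c\<close>. The choice is the same for all points, as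
  a midpoint of two points with different behaviour would have no admissible image.
\<close>

lemma isometry_fixing_pencil:
  assumes f: "isometry f" and c: "f c = c" and dir: "\<And>x. col c x (f x)"
  shows "(\<forall>x. f x = x) \<or> (\<forall>x. f x = point_refl c x)"
proof -
  have alt: "f x = x \<or> f x = point_refl c x" for x
  proof (cases "f x = x")
    case False
    have "congr c x c (f x)" using congr_sym[OF isometryD[OF f, of c x]] c by simp
    then have "midp c x (f x)" by (rule col_congr_midp[OF col_swap[OF dir]]) (use False in simp)
    then show ?thesis using point_refl_eq by metis
  qed simp
  have False if x: "f x \<noteq> x" and y: "f y \<noteq> point_refl c y" for x y
  proof -
    have fx: "f x = point_refl c x" and fy: "f y = y" using alt x y by blast+
    have ne: "x \<noteq> c" "y \<noteq> c" using x y c by auto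
    have eq: "f (mid x y) = mid (point_refl c x) y" using isometry_mid[OF f] fx fy by metis
    from alt[of "mid x y"] show False
    proof
      assume "f (mid x y) = mid x y"
      then have "point_refl c x = x" using eq mid_cancel by metis
      then show False using ne point_refl_fixed by blast
    next
      assume "f (mid x y) = point_refl c (mid x y)"
      then have "mid y (point_refl c x) = mid (point_refl c y) (point_refl c x)" 
        using eq isometry_mid[OF isometry_point_refl] mid_comm by metis
      then have "point_refl c y = y" using mid_cancel by metis
      then show False using ne point_refl_fixed by blast
    qed
  qed
  then show ?thesis by blast
qed

text \<open>
  With \<open>d = m\<close>, the midpoint of \<open>c\<close> and its image, the composition \<open>g\<close> with the reflection in \<open>m\<close>
  fixes \<open>c\<close> and, like every product of point reflections, maps lines to parallels. If it were the
  reflection in \<open>c\<close> and not the identity, the product of the reflections in \<open>a\<close> and \<open>b\<close> would be the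
  reflection in \<open>m\<close> and so fix \<open>m\<close>, which a translation by a nonzero vector does not.
\<close>

lemma three_point_refls: "\<exists>d. \<forall>x. point_refl a (point_refl b (point_refl c x)) = point_refl d x"
proof (cases "a = b")
  case True then show ?thesis by auto
next
  case False
  define m where "m = mid c (point_refl a (point_refl b c))"
  define g where "g x = point_refl m (point_refl a (point_refl b (point_refl c x)))" for x
  have gi: "isometry g" unfolding g_def 
    by (rule isometry_comp[OF isometry_point_refl isometry_comp[OF isometry_point_refl 
          isometry_comp[OF isometry_point_refl isometry_point_refl]]])
  have gc: "g c = c" unfolding g_def m_def by simp
  have "col c x (g x)" for x
  proof (cases "x = c")
    case True then show ?thesis using col_triv by blast
  next
    case xc: False
    have step: "par c x (point_refl p y) (point_refl p z)" if "par c x y z" for p y z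
      using par_trans[OF that par_point_refl] that unfolding par_def by blast
    have "par c x c x" unfolding par_def using xc by simp
    then have "par c x (g c) (g x)" unfolding g_def by (intro step)
    then have "g x \<in> line c x" unfolding par_def gc using line_mem by blast
    then show ?thesis unfolding line_def by blast
  qed
  then consider "\<forall>x. g x = x" | "\<forall>x. g x = point_refl c x" 
    using isometry_fixing_pencil[OF gi gc] by blast
  then show ?thesis
  proof cases
    case 1
    then show ?thesis unfolding g_def using point_refl_invol by metis
  next
    case 2
    then have "point_refl m (point_refl a (point_refl b y)) = y" for y
      unfolding g_def using point_refl_invol by metis
    then have "point_refl a (point_refl b m) = m" using point_refl_invol point_refl_centre by metis
    then have "point_refl b m = point_refl a m" using point_refl_invol by metis
    then have "a = b" using point_refl_midp mid_eq by metis
    then show ?thesis using False by blast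
  qed
qed

section \<open>Reflections in lines\<close>

definition line_refl :: "'a \<Rightarrow> 'a \<Rightarrow> 'a \<Rightarrow> 'a" where
  "line_refl A B X = point_refl (THE M. is_foot A B X M) X"

lemma line_refl_eq: "is_foot A B X M \<Longrightarrow> line_refl A B X = point_refl M X"
  unfolding line_refl_def using the_equality[of "is_foot A B X"] is_foot_unique by metis

lemma line_refl_foot:
  assumes "A \<noteq> B"
  obtains M where "is_foot A B X M" "line_refl A B X = point_refl M X"
  using is_foot_exists[OF assms] line_refl_eq by blast

lemma line_refl_line:
  assumes "line A B = line C D"
  shows "line_refl A B = line_refl C D"
proof -
  have "col A B Z \<longleftrightarrow> col C D Z" for Z using assms unfolding line_def by blast
  then show ?thesis unfolding line_refl_def is_foot_def by auto
qed

lemma line_refl_fixed: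
  assumes "A \<noteq> B"
  shows "line_refl A B X = X \<longleftrightarrow> col A B X"
proof
  obtain M where M: "is_foot A B X M" "line_refl A B X = point_refl M X" 
    using line_refl_foot[OF assms] .
  show "col A B X" if "line_refl A B X = X"
    using that M point_refl_fixed is_foot_def by metis
  show "line_refl A B X = X" if "col A B X"
  proof -
    have "is_foot A B X X" unfolding is_foot_def using that per_triv by blast
    then show ?thesis using line_refl_eq by fastforce
  qed
qed

lemma line_refl_invol:
  assumes "A \<noteq> B"
  shows "line_refl A B (line_refl A B X) = X"
proof -
  obtain M where M: "is_foot A B X M" "line_refl A B X = point_refl M X" 
    using line_refl_foot[OF assms] .
  then have "is_foot A B (point_refl M X) M" unfolding is_foot_def using per_point_refl by blast
  then show ?thesis using M line_refl_eq by simp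
qed

text \<open>
  The point reflection in the midpoint \<open>Z\<close> of the two feet carries \<open>P\<close>, \<open>P'\<close> to points \<open>R\<close>, \<open>R'\<close> that have
  the same foot \<open>Y\<close> as \<open>Q\<close>, \<open>Q'\<close>. There the reflection in the line agrees with the one in the point \<open>Y\<close>, and the
  five-segment axiom takes the congruence through \<open>Z\<close> back to \<open>P\<close>, \<open>P'\<close>.
\<close>

lemma isometry_line_refl:
  assumes "A \<noteq> B"
  shows "isometry (line_refl A B)"
  unfolding isometry_def
proof (intro allI)
  fix P Q
  obtain X where X: "is_foot A B P X" "line_refl A B P = point_refl X P" 
    using line_refl_foot[OF assms] .
  obtain Y where Y: "is_foot A B Q Y" "line_refl A B Q = point_refl Y Q" 
    using line_refl_foot[OF assms] .
  define P' Q' where "P' = point_refl X P" and "Q' = point_refl Y Q"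
  define Z where "Z = mid X Y"
  define R R' where "R = point_refl Z P" and "R' = point_refl Z P'"
  have "col A B Z" unfolding Z_def using line_mid assms X Y is_foot_def by blast
  then have "per Z X P" "per Z Y Q" using X Y is_foot_def by blast+
  then have ZP: "congr Z P Z P'" and ZQ: "congr Z Q Z Q'" 
    unfolding P'_def Q'_def using per_sym per_def by blast+
  have "midp (point_refl Z X) R R'" unfolding R_def R'_def P'_def
    using isometry_midp isometry_point_refl point_refl_midp by blast
  then have "point_refl Y R = R'" unfolding Z_def using point_refl_eq by simp
  then have RQ: "congr R Q R' Q'" 
    using point_refl_isometry[of Y R Q] congr_sym unfolding Q'_def by blast
  have "congr Z R Z P" "congr Z R' Z P'" unfolding R_def R'_def by (rule point_refl_radius)+
  then have ZR: "congr R Z R' Z" using ZP by (simp add: congr_len len_comm)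
  have b: "bet R Z P" "bet R' Z P'" unfolding R_def R'_def using point_refl_bet bet_sym by blast+
  have "congr P Q P' Q'"
  proof (cases "R = Z")
    case True
    then have "P = Z" unfolding R_def using point_refl_invol point_refl_centre by metis
    then have "P' = Z" using ZP congr_null_iff by blast
    then show ?thesis using ZQ \<open>P = Z\<close> by simp
  next
    case False
    then show ?thesis using five_segment[OF False b ZR ZP RQ ZQ] by blast
  qed
  then show "congr (line_refl A B P) (line_refl A B Q) P Q" 
    using X Y congr_sym unfolding P'_def Q'_def by metis
qed

lemma equidistant_col:
  assumes "X \<noteq> Y" "congr A X A Y" "congr B X B Y" "congr C X C Y"
  shows "col A B C"
  using upper_dimension[OF assms] unfolding col_def .

lemma line_refl_unique:
  assumes AB: "A \<noteq> B" and XY: "X \<noteq> Y" and A: "congr A X A Y" and B: "congr B X B Y"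
  shows "line_refl A B X = Y"
proof -
  define M where "M = mid X Y"
  have M: "midp M X Y" unfolding M_def by (rule mid_midp)
  have c: "col A B M" using equidistant_col[OF XY A B midp_congr[OF M]] .
  have "per X M A" "per X M B" 
    unfolding per_def point_refl_eq[OF M] using A B by blast+
  then have "is_foot A B X M" 
    using is_footI[OF AB c, of A X] is_footI[OF AB c, of B X] per_sym AB col_triv by blast
  then show ?thesis using line_refl_eq point_refl_eq[OF M] by simp
qed

text \<open>
  The image of each point has the same distances to \<open>A\<close> and \<open>B\<close>, which leaves two choices. A fixed point off the line
  would be equidistant from a moved point and its mirror image, so the choice is uniform.
\<close>

lemma isometry_two_fixed:
  assumes AB: "A \<noteq> B" and f: "isometry f" and A: "f A = A" and B: "f B = B"
  shows "f = (\<lambda>x. x) \<or> f = line_refl A B"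
proof -
  have c: "congr A x A (f x)" "congr B x B (f x)" for x
    using congr_sym[OF isometryD[OF f]] A B by metis+
  have alt: "f x = x \<or> f x = line_refl A B x" for x
    using line_refl_unique[OF AB _ c, of x] by metis
  have False if x: "f x \<noteq> x" and y: "f y \<noteq> line_refl A B y" for x y
  proof -
    have "f y = y" using alt y by blast
    then have "congr y x y (f x)" using congr_sym[OF isometryD[OF f, of y x]] by simp
    then have "col A B y" using equidistant_col[of x "f x" A B y] c x by metis
    then show False using line_refl_fixed[OF AB] y \<open>f y = y\<close> by metis
  qed
  then show ?thesis by blast
qed

text \<open>
  The product is itself a point reflection, hence an involution.
\<close>

lemma point_refls_reverse:
  "point_refl a (point_refl b (point_refl c x)) = point_refl c (point_refl b (point_refl a x))"
proof -
  obtain d where d: "\<And>x. point_refl a (point_refl b (point_refl c x)) = point_refl d x"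
    using three_point_refls by blast
  have "point_refl d (point_refl c (point_refl b (point_refl a x))) = x" 
    unfolding d[symmetric] by simp
  then show ?thesis unfolding d using point_refl_invol by metis
qed

section \<open>The vector group\<close>

context
  fixes org :: 'a
begin

text \<open>
  The sum is the image of \<open>y\<close> under the translation that takes the origin to \<open>x\<close>, a product of two
  point reflections.
\<close>

definition vadd :: "'a \<Rightarrow> 'a \<Rightarrow> 'a" (infixl "\<oplus>" 65) where
  "x \<oplus> y = point_refl (mid org x) (point_refl org y)"

definition vneg :: "'a \<Rightarrow> 'a" where
  "vneg x = point_refl org x"

definition vsub :: "'a \<Rightarrow> 'a \<Rightarrow> 'a" (infixl "\<ominus>" 65) where
  "x \<ominus> y = x \<oplus> vneg y"

lemma vadd_comm: "x \<oplus> y = y \<oplus> x"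
  unfolding vadd_def using point_refls_reverse[of "mid org x" org "mid org y" org] by simp

lemma vadd_assoc: "(x \<oplus> y) \<oplus> z = x \<oplus> (y \<oplus> z)"
proof -
  obtain d where d: "\<And>w. point_refl (mid org x) (point_refl org (point_refl (mid org y) w)) = point_refl d w"
    using three_point_refls by blast
  have "point_refl d org = x \<oplus> y" unfolding d[symmetric] vadd_def by simp
  then have "mid org (x \<oplus> y) = d" using mid_eq point_refl_midp by metis
  then show ?thesis unfolding vadd_def[of "x \<oplus> y"] using d unfolding vadd_def by simp
qed

lemma vadd_zero: "org \<oplus> x = x"
  unfolding vadd_def using mid_eq[of org org org] midp_same by simp

lemma vneg_left: "vneg x \<oplus> x = org"
  unfolding vadd_comm[of "vneg x"] vadd_def vneg_def by simp

interpretation V: ab_group_add vadd org vsub vneg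
  by unfold_locales (simp_all add: vadd_assoc vadd_zero vneg_left vsub_def, rule vadd_comm)

text \<open>
  Conjugating the reflection in the origin by the one that exchanges the origin and \<open>m\<close> gives the case \<open>x = org\<close>.
\<close>

lemma point_refl_vec: "point_refl m x = (m \<oplus> m) \<ominus> x"
proof -
  define h where "h = mid org m"
  have "point_refl h (point_refl org (point_refl h org)) 
      = point_refl (point_refl h org) (point_refl h (point_refl h org))"
    by (rule isometry_point_refl_conj[OF isometry_point_refl])
  then have mm: "m \<oplus> m = point_refl m org" unfolding vadd_def h_def by simp
  have "mid org (point_refl m org) = m" using mid_eq point_refl_midp by blast
  then show ?thesis unfolding vsub_def mm vneg_def vadd_def[of "point_refl m org"] by simp
qed

lemma mid_double: "mid x y \<oplus> mid x y = x \<oplus> y"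
proof -
  have "y = (mid x y \<oplus> mid x y) \<ominus> x" using point_refl_vec point_refl_mid by metis
  then show ?thesis by (metis V.add.commute V.diff_add_cancel)
qed

lemma double_inj: "x \<oplus> x = y \<oplus> y \<Longrightarrow> x = y"
  using point_refl_vec[of x org] point_refl_vec[of y org] point_refl_midp mid_eq by metis

lemma mid_vecI: "m \<oplus> m = x \<oplus> y \<Longrightarrow> mid x y = m"
  using mid_double double_inj by metis

text \<open>
  An isometry respects midpoints and point reflections, and addition is made of these.
\<close>

lemma isometry_vadd: "isometry f \<Longrightarrow> f org = org \<Longrightarrow> f (x \<oplus> y) = f x \<oplus> f y"
  unfolding vadd_def using isometry_point_refl_conj isometry_mid by metis

lemma isometry_vneg: "isometry f \<Longrightarrow> f org = org \<Longrightarrow> f (vneg x) = vneg (f x)"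
  unfolding vneg_def using isometry_point_refl_conj by metis

lemma isometry_vsub: "isometry f \<Longrightarrow> f org = org \<Longrightarrow> f (x \<ominus> y) = f x \<ominus> f y"
  unfolding vsub_def using isometry_vadd isometry_vneg by metis

lemma isometry_translation: "isometry (\<lambda>x. a \<oplus> x)"
  unfolding vadd_def by (rule isometry_comp[OF isometry_point_refl isometry_point_refl])

lemma vneg_vadd: "vneg a \<oplus> b = b \<ominus> a"
  unfolding vsub_def by (rule vadd_comm)

lemma congr_vec: "congr a b c d \<longleftrightarrow> congr org (b \<ominus> a) org (d \<ominus> c)"
proof -
  have "congr a b org (b \<ominus> a)" for a b
    using congr_sym[OF isometryD[OF isometry_translation, of "vneg a" a b]] 
    by (simp add: vneg_vadd)
  then show ?thesis by (simp add: congr_len)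
qed

lemma bet_translate: "bet (x \<oplus> a) (x \<oplus> b) (x \<oplus> c) \<longleftrightarrow> bet a b c"
  using isometry_bet[OF isometry_translation, of a b c x] 
    isometry_bet[OF isometry_translation, of "x \<oplus> a" "x \<oplus> b" "x \<oplus> c" "vneg x"]
  by (auto simp: V.add.assoc[symmetric])

lemma col_translate: "col (x \<oplus> a) (x \<oplus> b) (x \<oplus> c) \<longleftrightarrow> col a b c"
  unfolding col_def bet_translate by blast

lemma col_vec: "col a b c \<longleftrightarrow> col org (b \<ominus> a) (c \<ominus> a)"
  using col_translate[of "vneg a" a b c] by (simp add: vneg_vadd)

lemma col_org_vadd: 
  assumes "col org x a" "col org x b"
  shows "col org x (a \<oplus> b)"
proof (cases "x = org")
  case True then show ?thesis using col_triv by simp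
next
  case False
  then have ne: "org \<noteq> x" by blast
  have "col org x (mid org a)" "col org x (point_refl org b)"
    using line_mid[OF ne _ assms(1)] line_point_refl[OF ne _ assms(2)] col_triv by blast+
  then show ?thesis unfolding vadd_def by (rule line_point_refl[OF ne])
qed

lemma col_org_vneg: "col org x a \<Longrightarrow> col org x (vneg a)"
  unfolding vneg_def using line_point_refl[of org x org a] col_triv by metis

lemma col_org_vsub: "col org x a \<Longrightarrow> col org x b \<Longrightarrow> col org x (a \<ominus> b)"
  unfolding vsub_def using col_org_vadd col_org_vneg by blast


section \<open>Reflections in lines through the origin\<close>

abbreviation refl_in :: "'a \<Rightarrow> 'a \<Rightarrow> 'a" where
  "refl_in p \<equiv> line_refl org p"

lemma isometry_refl_in: "p \<noteq> org \<Longrightarrow> isometry (refl_in p)"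
  using isometry_line_refl by metis

lemma refl_in_fixed: "p \<noteq> org \<Longrightarrow> refl_in p x = x \<longleftrightarrow> col org p x"
  using line_refl_fixed by metis

lemma refl_in_org: "p \<noteq> org \<Longrightarrow> refl_in p org = org"
  using refl_in_fixed col_triv by blast

lemma refl_in_self: "p \<noteq> org \<Longrightarrow> refl_in p p = p"
  using refl_in_fixed col_triv by blast

lemma refl_in_invol: "p \<noteq> org \<Longrightarrow> refl_in p (refl_in p x) = x"
  using line_refl_invol by metis

lemma refl_in_vadd: "p \<noteq> org \<Longrightarrow> refl_in p (x \<oplus> y) = refl_in p x \<oplus> refl_in p y"
  by (rule isometry_vadd[OF isometry_refl_in refl_in_org])

lemma refl_in_vneg: "p \<noteq> org \<Longrightarrow> refl_in p (vneg x) = vneg (refl_in p x)"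
  by (rule isometry_vneg[OF isometry_refl_in refl_in_org])

lemma refl_in_vsub: "p \<noteq> org \<Longrightarrow> refl_in p (x \<ominus> y) = refl_in p x \<ominus> refl_in p y"
  by (rule isometry_vsub[OF isometry_refl_in refl_in_org])

lemma refl_in_mid: "p \<noteq> org \<Longrightarrow> refl_in p (mid x y) = mid (refl_in p x) (refl_in p y)"
  by (rule isometry_mid[OF isometry_refl_in])

lemma refl_in_ne: "p \<noteq> org \<Longrightarrow> x \<noteq> org \<Longrightarrow> refl_in p x \<noteq> org"
  using refl_in_invol refl_in_org by metis

lemma refl_in_norm: "p \<noteq> org \<Longrightarrow> congr org (refl_in p x) org x"
  using isometryD[OF isometry_refl_in, of p org x] refl_in_org by simp

lemma refl_in_cong_line: "p \<noteq> org \<Longrightarrow> q \<noteq> org \<Longrightarrow> col org p q \<Longrightarrow> refl_in q = refl_in p"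
  by (rule line_refl_line, rule line_eq_start) (auto simp: line_def)

text \<open>
  The conjugate fixes the origin and the image of \<open>q\<close>; it is not the identity because the reflection in \<open>q\<close> is
  not.
\<close>

lemma refl_in_conj:
  assumes "p \<noteq> org" "q \<noteq> org"
  shows "refl_in (refl_in p q) z = refl_in p (refl_in q (refl_in p z))"
proof -
  define f where "f z = refl_in p (refl_in q (refl_in p z))" for z
  have ne: "org \<noteq> refl_in p q" using refl_in_ne assms by metis
  have "isometry f" unfolding f_def
    by (rule isometry_comp[OF isometry_refl_in isometry_comp[OF isometry_refl_in isometry_refl_in]]) (use assms in auto)
  moreover have "f org = org" "f (refl_in p q) = refl_in p q"
    unfolding f_def using assms by (simp_all add: refl_in_org refl_in_invol refl_in_self)
  ultimately have "f = (\<lambda>x. x) \<or> f = refl_in (refl_in p q)" using isometry_two_fixed[OF ne] by blast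
  moreover have "f \<noteq> (\<lambda>x. x)"
  proof
    assume id: "f = (\<lambda>x. x)"
    have "refl_in q w = w" for w 
      using fun_cong[OF id, of "refl_in p w"] refl_in_invol[OF assms(1)] unfolding f_def by metis
    then show False using refl_in_fixed[OF assms(2)] exists_not_col[of org q] assms by metis
  qed
  ultimately show ?thesis unfolding f_def by metis
qed

text \<open>
  The axis goes through the midpoint of \<open>x\<close> and \<open>y\<close>; if that is the origin, it is the perpendicular
  to \<open>x\<close>.
\<close>

lemma refl_in_swap:
  assumes x: "x \<noteq> org" and xy: "congr org x org y"
  shows "\<exists>s. s \<noteq> org \<and> refl_in s x = y"
proof -
  consider "x = y" | "x \<noteq> y" "mid x y \<noteq> org" | "x \<noteq> y" "mid x y = org" by blast
  then show ?thesis
  proof cases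
    case 1 then show ?thesis using refl_in_self x by blast
  next
    case 2
    have "refl_in (mid x y) x = y"
      by (rule line_refl_unique[OF 2(2)[symmetric] 2(1) xy midp_congr[OF mid_midp]])
    then show ?thesis using 2 by blast
  next
    case 3
    obtain c where c: "\<not> col org x c" using exists_not_col x by metis
    then obtain s where s: "per x org s" "s \<noteq> org" using perpendicular_at[of org x c] x by metis
    have "is_foot org s x org" 
      using is_footI[of org s org s x] s per_sym col_triv by metis
    then have "refl_in s x = point_refl org x" by (rule line_refl_eq)
    then show ?thesis using s 3 point_refl_mid(1)[of x y] by metis
  qed
qed

text \<open>
  Let \<open>s\<close> be an axis that takes \<open>c\<close> to its image under the product \<open>T\<close>. The product of the reflection in \<open>s\<close>
  and \<open>T\<close> fixes \<open>c\<close>. If it were the reflection in \<open>c\<close>, the product of the reflections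
  in \<open>a\<close> and \<open>b\<close> would be the reflection in \<open>s\<close>; but a product of two different reflections fixes only
  the origin.
\<close>

lemma three_refl_in:
  assumes a: "a \<noteq> org" and b: "b \<noteq> org" and c: "c \<noteq> org"
  shows "\<exists>s. s \<noteq> org \<and> (\<forall>z. refl_in a (refl_in b (refl_in c z)) = refl_in s z)"
proof (cases "refl_in a = refl_in b")
  case True then show ?thesis using b c refl_in_invol by metis
next
  case False
  define T where "T z = refl_in a (refl_in b (refl_in c z))" for z
  have Ti: "isometry T" unfolding T_def
    by (rule isometry_comp[OF isometry_refl_in isometry_comp[OF isometry_refl_in isometry_refl_in]]) (use assms in auto)
  have T0: "T org = org" unfolding T_def using assms by (simp add: refl_in_org)
  have "congr org c org (T c)" using congr_sym[OF isometryD[OF Ti, of org c]] T0 by simp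
  then obtain s where s: "s \<noteq> org" "refl_in s c = T c" using refl_in_swap[OF c] by blast
  define g where "g z = refl_in s (T z)" for z
  have gi: "isometry g" unfolding g_def by (rule isometry_comp[OF isometry_refl_in[OF s(1)] Ti])
  have "g org = org" "g c = c" unfolding g_def using T0 s refl_in_org refl_in_invol by metis+
  then consider "g = (\<lambda>x. x)" | "g = refl_in c" using isometry_two_fixed[OF c[symmetric] gi] by blast
  then show ?thesis
  proof cases
    case 1
    then have "T z = refl_in s z" for z using fun_cong[OF 1, of z] refl_in_invol[OF s(1)] unfolding g_def by metis
    then show ?thesis using s unfolding T_def by blast
  next
    case 2
    then have "refl_in s (refl_in a (refl_in b z)) = z" for z 
      using fun_cong[OF 2, of "refl_in c z"] refl_in_invol[OF c] unfolding g_def T_def by metis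
    then have "refl_in a (refl_in b s) = s" using s refl_in_invol refl_in_self by metis
    then have w: "refl_in b s = refl_in a s" using refl_in_invol a by metis
    have "refl_in a = refl_in b"
    proof (cases "refl_in a s = s")
      case True
      then show ?thesis using w refl_in_fixed refl_in_cong_line a b s by metis
    next
      case False
      have "congr a s a (refl_in a s)" "congr b s b (refl_in a s)"
        using isometryD[OF isometry_refl_in[OF a], of a s] isometryD[OF isometry_refl_in[OF b], of b s] 
          refl_in_self[OF a] refl_in_self[OF b] w by (metis congr_sym)+
      moreover have "congr org s org (refl_in a s)" using refl_in_norm[OF a] congr_sym by blast
      ultimately have "col org a b" using equidistant_col[of s "refl_in a s" org a b] False by metis
      then show ?thesis using refl_in_cong_line a b by metis
    qed
    then show ?thesis using False by blast
  qed
qed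

lemma refl_in_reverse:
  assumes "a \<noteq> org" "b \<noteq> org" "c \<noteq> org"
  shows "refl_in a (refl_in b (refl_in c z)) = refl_in c (refl_in b (refl_in a z))"
proof -
  obtain s where s: "s \<noteq> org" "\<And>z. refl_in a (refl_in b (refl_in c z)) = refl_in s z" using three_refl_in[OF assms] by blast
  have "refl_in s (refl_in c (refl_in b (refl_in a z))) = z" unfolding s(2)[symmetric] using assms by (simp add: refl_in_invol)
  then show ?thesis using s refl_in_invol by metis
qed

section \<open>Scalings\<close>

text \<open>
  For the rotation that is the product of the reflections in \<open>p\<close> and \<open>s\<close>, the midpoint of the images of \<open>z\<close> under it
  and under its inverse, i.e. \<open>z\<close> multiplied by the cosine of the angle of rotation.
\<close>

definition scaling :: "'a \<Rightarrow> 'a \<Rightarrow> 'a \<Rightarrow> 'a" where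
  "scaling s p z = mid (refl_in s (refl_in p z)) (refl_in p (refl_in s z))"

context
  fixes s p :: 'a
  assumes s: "s \<noteq> org" and p: "p \<noteq> org"
begin

text \<open>
  A reflection conjugates the rotation to its inverse, and the midpoint does not see which is which.
\<close>

lemma scaling_refl_in: "x \<noteq> org \<Longrightarrow> scaling s p (refl_in x z) = refl_in x (scaling s p z)"
  unfolding scaling_def refl_in_mid using refl_in_reverse s p mid_comm refl_in_mid by metis

lemma scaling_vadd: "scaling s p (x \<oplus> y) = scaling s p x \<oplus> scaling s p y"
  unfolding scaling_def
proof (rule mid_vecI)
  have "mid u v \<oplus> mid u' v' \<oplus> (mid u v \<oplus> mid u' v') = (u \<oplus> v) \<oplus> (u' \<oplus> v')" for u v u' v'
  proof -
    have "mid u v \<oplus> mid u' v' \<oplus> (mid u v \<oplus> mid u' v') 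
      = (mid u v \<oplus> mid u v) \<oplus> (mid u' v' \<oplus> mid u' v')"
      by (simp only: V.add.assoc V.add.commute V.add.left_commute)
    then show ?thesis by (simp only: mid_double)
  qed
  then show "mid (refl_in s (refl_in p x)) (refl_in p (refl_in s x)) \<oplus> mid (refl_in s (refl_in p y)) (refl_in p (refl_in s y)) \<oplus>
     (mid (refl_in s (refl_in p x)) (refl_in p (refl_in s x)) \<oplus> mid (refl_in s (refl_in p y)) (refl_in p (refl_in s y))) =
     refl_in s (refl_in p (x \<oplus> y)) \<oplus> refl_in p (refl_in s (x \<oplus> y))"
    using s p by (simp add: refl_in_vadd V.add.assoc V.add.commute V.add.left_commute)
qed

lemma scaling_org: "scaling s p org = org"
  using scaling_vadd[of org org] by (metis V.add_cancel_right_left V.add_0)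

lemma scaling_vneg: "scaling s p (vneg x) = vneg (scaling s p x)"
  using scaling_vadd[of x "vneg x"] scaling_org by (metis V.add.right_inverse V.minus_unique)

lemma scaling_vsub: "scaling s p (x \<ominus> y) = scaling s p x \<ominus> scaling s p y"
  unfolding vsub_def scaling_vadd scaling_vneg ..

lemma scaling_mid: "scaling s p (mid x y) = mid (scaling s p x) (scaling s p y)"
  using mid_vecI[of "scaling s p (mid x y)" "scaling s p x" "scaling s p y"] scaling_vadd mid_double by metis

text \<open>
  \<open>\<rho> x\<close> and \<open>\<rho>\<^sup>-\<^sup>1 x\<close> are the ends of a base parallel to the base of the isosceles triangle
  formed by the origin, \<open>\<rho> y\<close> and \<open>\<rho>\<^sup>-\<^sup>1 y\<close>; the altitude of the latter passes through both
  midpoints.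
\<close>

lemma scaling_bet: 
  assumes "bet org x y"
  shows "bet org (scaling s p x) (scaling s p y)"
proof -
  define a a' b b' where "a = refl_in s (refl_in p x)" and "a' = refl_in p (refl_in s x)"
    and "b = refl_in s (refl_in p y)" and "b' = refl_in p (refl_in s y)"
  have ab: "bet org a b" "bet org a' b'" 
    using isometry_bet[OF isometry_comp[OF isometry_refl_in[OF s] isometry_refl_in[OF p]] assms]
      isometry_bet[OF isometry_comp[OF isometry_refl_in[OF p] isometry_refl_in[OF s]] assms] refl_in_org s p 
    unfolding a_def a'_def b_def b'_def by simp_all
  have n: "congr a org a' org" "congr b org b' org"
    unfolding a_def a'_def b_def b'_def
    using congr_trans[OF refl_in_norm[OF s] congr_trans[OF refl_in_norm[OF p] congr_sym[OF congr_trans[OF refl_in_norm[OF p] refl_in_norm[OF s]]]]]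
    by (blast intro: congr_both)+
  define m where "m = mid b b'"
  have m: "bet b m b'" "congr m b m b'" unfolding m_def using mid_midp midp_def midp_congr by blast+
  obtain Q where Q: "bet m Q org" "bet a Q a'" 
    using pasch_cevian[OF bet_sym[OF ab(1)] bet_sym[OF ab(2)] m(1)] by blast
  have "congr Q a Q a'"
  proof (cases "m = org")
    case True then show ?thesis using Q bet_identity n congr_both by metis
  next
    case False
    have "congr a m a' m"
      by (rule inner_five_segment[OF bet_sym[OF ab(1)] bet_sym[OF ab(2)] n(2,1) congr_both[OF m(2)] congr_refl])
    then show ?thesis 
      using col_equidistant[OF False _ congr_both congr_both[OF n(1)]] Q(1) bet_col col_rot col_swap by blast
  qed
  then have "mid a a' = Q" using mid_eq midp_def Q congr_left by blast
  then show ?thesis using Q bet_sym unfolding scaling_def m_def a_def a'_def b_def b'_def by blast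
qed

text \<open>
  The scaling kills \<open>x\<close> exactly if \<open>-\<rho>\<^sup>2\<close> fixes \<open>x\<close>, and an isometry that fixes the origin and \<open>x\<close> fixes the line
  through them.
\<close>

lemma scaling_kernel:
  assumes x: "scaling s p x = org" "x \<noteq> org" and y: "col org x y"
  shows "scaling s p y = org"
proof -
  define f where "f z = vneg (refl_in s (refl_in p (refl_in s (refl_in p z))))" for z
  have fi: "isometry f" unfolding f_def vneg_def
    by (rule isometry_comp[OF isometry_point_refl isometry_comp[OF isometry_refl_in isometry_comp[OF isometry_refl_in 
            isometry_comp[OF isometry_refl_in isometry_refl_in]]]]) (use s p in auto)
  have iff: "scaling s p z = org \<longleftrightarrow> f z = z" for z
  proof -
    have "scaling s p z = org \<longleftrightarrow> vneg (refl_in s (refl_in p z)) = refl_in p (refl_in s z)"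
      unfolding scaling_def vneg_def using point_refl_mid mid_eq point_refl_midp by metis
    also have "\<dots> \<longleftrightarrow> refl_in s (refl_in p (vneg (refl_in s (refl_in p z)))) = z"
      using refl_in_invol s p by metis
    finally show ?thesis unfolding f_def using s p by (simp add: refl_in_vneg)
  qed
  have "f org = org" unfolding f_def using s p by (simp add: refl_in_org vneg_def)
  moreover have "f x = x" using iff x by blast
  ultimately have "congr org y org (f y)" "congr x y x (f y)"
    using congr_sym[OF isometryD[OF fi, of org y]] congr_sym[OF isometryD[OF fi, of x y]] by simp_all
  then have "y = f y" using col_point_unique[of org x y "f y"] x(2) y by metis
  then show ?thesis using iff by metis
qed

end

lemma scaling_comm:
  assumes "s \<noteq> org" "p \<noteq> org" "t \<noteq> org" "q \<noteq> org"
  shows "scaling s p (scaling t q z) = scaling t q (scaling s p z)"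
  unfolding scaling_def[of s p] scaling_mid[OF assms(3,4)] using assms by (simp add: scaling_refl_in)

lemma vneg_ray:
  assumes "same_ray org x y"
  shows "strict_bet x org (vneg y)"
proof -
  have ne: "x \<noteq> org" "y \<noteq> org" using assms same_ray_def by blast+
  have b: "bet y org (vneg y)" unfolding vneg_def by (rule point_refl_bet)
  have "bet x org (vneg y)"
    using assms b ne unfolding same_ray_def using bet_inner_trans bet_outer_trans bet_outer_trans' bet_sym
    bet_exchange3 by meson
  then show ?thesis unfolding strict_bet_def using ne by (metis V.neg_equal_0_iff_equal)
qed

text \<open>
  The cosine has the same sign on all vectors: a reflection moves \<open>x\<close> to the ray of \<open>p\<close> and, on this ray,
  scalings preserve betweenness.
\<close>

lemma scaling_ray:
  assumes s: "s \<noteq> org" and p: "p \<noteq> org" and q: "scaling s p p \<noteq> org" "bet org (scaling s p p) p" 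
    and x: "x \<noteq> org"
  shows "same_ray org x (scaling s p x)"
proof -
  obtain x' where x': "same_ray org p x'" "congr org x' org x"
    using lay_off[of p org org x] p x by metis
  have x'0: "x' \<noteq> org" using x' same_ray_def by blast
  obtain u where u: "u \<noteq> org" "refl_in u x' = x" using refl_in_swap x'0 x' by blast
  have c: "col org x' p" using x' unfolding same_ray_def col_def using bet_sym by blast
  have ne: "scaling s p x' \<noteq> org" using scaling_kernel[OF s p _ x'0 c] q by blast
  have "same_ray org x' p" using x' same_ray_sym by blast
  moreover have "same_ray org p (scaling s p p)" unfolding same_ray_def using p q by blast
  moreover have "same_ray org (scaling s p p) (scaling s p x')" 
    using x' scaling_bet[OF s p] ne q unfolding same_ray_def by blast
  ultimately have "same_ray org x' (scaling s p x')" using same_ray_trans by blast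
  then have "same_ray org (refl_in u x') (refl_in u (scaling s p x'))"
    using isometry_bet[OF isometry_refl_in[OF u(1)], of org] refl_in_org[OF u(1)] refl_in_ne[OF u(1)] 
    unfolding same_ray_def by metis
  then show ?thesis using scaling_refl_in[OF s p u(1), of x'] u(2) by simp
qed

text \<open>
  Line-circle continuity gives a point \<open>r\<close> at the distance of \<open>p\<close> that projects to \<open>q\<close>; the
  rotation takes \<open>p\<close> to \<open>r\<close>.
\<close>

lemma scaling_exists:
  assumes p: "p \<noteq> org" and q: "q \<noteq> org" and b: "bet org q p"
  shows "\<exists>s. s \<noteq> org \<and> scaling s p p = q"
proof -
  obtain r where r: "congr org p org r" "mid r (refl_in p r) = q"
  proof (cases "q = p")
    case True
    then show ?thesis using that[of p] congr_refl refl_in_self p mid_eq midp_same by metis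
  next
    case False
    obtain c where "\<not> col q org c" using exists_not_col q by blast
    then obtain u where u: "per org q u" "u \<noteq> q" using perpendicular_at q by blast
    obtain r where r: "congr org r org p" "col q u r"
      using line_circle[OF u(2)[symmetric] _ b False congr_refl] bet_triv1 bet_triv2 
      unfolding col_def by metis
    have "per r q org" using per_col[OF per_sym[OF u(1)] u(2)] r(2) col_swap by blast
    then have "is_foot org p r q" 
      using is_footI[of org p q org r] p q b per_sym col_triv bet_col col_rot col_swap by metis
    then have "refl_in p r = point_refl q r" by (rule line_refl_eq)
    then have "mid r (refl_in p r) = q" using mid_eq point_refl_midp by simp
    then show ?thesis using that r congr_sym by blast
  qed
  obtain s where s: "s \<noteq> org" "refl_in s p = r" using refl_in_swap[OF p r(1)] by blast
  have "scaling s p p = q" unfolding scaling_def using s r refl_in_self[OF p] by simp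
  then show ?thesis using s by blast
qed


section \<open>Orthogonal vectors and equal rectangles\<close>

text \<open>
  The diagonals of the parallelogram on \<open>x\<close>, \<open>y\<close> are congruent, a condition that is symmetric in \<open>x\<close> and \<open>y\<close>.
\<close>

definition vperp :: "'a \<Rightarrow> 'a \<Rightarrow> bool" where
  "vperp x y \<longleftrightarrow> congr org (x \<oplus> y) org (x \<ominus> y)"

lemma norm_vneg: "congr org (vneg x) org x"
  unfolding vneg_def by (rule point_refl_radius)

lemma vperp_sym: "vperp x y \<Longrightarrow> vperp y x"
  using norm_vneg[of "x \<ominus> y"] unfolding vperp_def by (simp add: congr_len V.add.commute)

lemma vperp_vneg: "vperp x y \<Longrightarrow> vperp x (vneg y)"
  unfolding vperp_def by (simp add: congr_len)

lemma vperp_vneg_left: "vperp x y \<Longrightarrow> vperp (vneg x) y"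
  using vperp_sym vperp_vneg by blast

lemma vsub_vadd_cancel: "a \<ominus> (a \<oplus> x) = vneg x"
  by (metis V.minus_diff_eq V.add_diff_cancel_left')

lemma vsub_vsub_cancel: "a \<ominus> (a \<ominus> x) = x"
  using vsub_vadd_cancel[of a "vneg x"] by simp

lemma vneg_eq: "vneg x = x \<longleftrightarrow> x = org"
  unfolding vneg_def by (rule point_refl_fixed)

lemma vperp_iff_refl_in:
  assumes x: "x \<noteq> org"
  shows "vperp x y \<longleftrightarrow> refl_in x y = vneg y"
proof
  assume "refl_in x y = vneg y"
  then have "refl_in x (x \<oplus> y) = x \<ominus> y" using x by (simp add: refl_in_vadd refl_in_self)
  then show "vperp x y" unfolding vperp_def using refl_in_norm[OF x, of "x \<oplus> y"] by (simp add: congr_len)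
next
  assume xy: "vperp x y"
  show "refl_in x y = vneg y"
  proof (cases "y = org")
    case True then show ?thesis using refl_in_org x by simp
  next
    case False
    have "vneg y \<ominus> x = vneg (x \<oplus> y)" by (simp only: vsub_def V.minus_add)
    then have "congr x y x (vneg y)"
      using vperp_sym[OF xy] norm_vneg[of "x \<oplus> y"] unfolding congr_vec[of x] vperp_def
      by (simp add: congr_len V.add.commute)
    moreover have "congr org y org (vneg y)" using norm_vneg congr_sym by blast
    moreover have "y \<noteq> vneg y" using vneg_eq False by metis
    ultimately show ?thesis using line_refl_unique[of org x y] x by metis
  qed
qed

lemma vperp_ne: "vperp x y \<Longrightarrow> x \<noteq> org \<Longrightarrow> x \<noteq> y"
  using vperp_iff_refl_in[of x x] refl_in_self vneg_eq by metis

lemma right_angle_vec: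
  assumes "vperp x y" "x \<noteq> org" "y \<noteq> org"
  shows "right_angle (b \<oplus> x) b (b \<oplus> y)"
  unfolding right_angle_def
proof (intro conjI exI)
  show "b \<noteq> b \<oplus> y" using assms by simp
  have "bet x org (vneg x)" unfolding vneg_def by (rule point_refl_bet)
  then have "bet (b \<oplus> x) b (b \<oplus> vneg x)" using bet_translate[of b x org "vneg x"] by simp
  moreover have "b \<noteq> b \<oplus> vneg x" using assms(2) V.add_cancel_right_right V.neg_equal_0_iff_equal by metis
  ultimately show "strict_bet (b \<oplus> x) b (b \<oplus> vneg x)" unfolding strict_bet_def using assms by simp
  show "congr (b \<oplus> x) b (b \<oplus> vneg x) b" 
    using norm_vneg[of x] unfolding congr_vec[of "b \<oplus> x"] by (simp add: congr_len vsub_vadd_cancel vsub_vsub_cancel)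
  show "congr (b \<oplus> x) (b \<oplus> y) (b \<oplus> vneg x) (b \<oplus> y)" 
    using vperp_sym[OF assms(1)] unfolding congr_vec[of "b \<oplus> x"] vperp_def
    by (simp add: congr_len algebra_simps)
qed

lemma right_angle_vecI:
  assumes "vperp (a \<ominus> b) (c \<ominus> b)" "a \<noteq> b" "c \<noteq> b"
  shows "right_angle a b c"
  using right_angle_vec[OF assms(1), of b] assms(2,3) by (simp add: V.add_diff_eq)

lemma rectangle_vec:
  assumes xy: "vperp x y" and ne: "x \<noteq> org" "y \<noteq> org" 
    and q: "q = a \<oplus> x" and r: "r = a \<oplus> x \<oplus> y" and t: "t = a \<oplus> y"
  shows "rectangle a q r t"
proof -
  have ne': "vneg x \<noteq> org" "vneg y \<noteq> org" using ne by simp_all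
  have 1: "right_angle t a q" 
    using right_angle_vec[OF vperp_sym[OF xy] ne(2,1), of a] unfolding q t .
  have 2: "right_angle a q r" 
    using right_angle_vec[OF vperp_vneg_left[OF xy] ne'(1) ne(2), of q] unfolding q r by (simp add: algebra_simps)
  have 3: "right_angle q r t" 
    using right_angle_vec[OF vperp_sym[OF vperp_vneg_left[OF vperp_vneg[OF xy]]] ne'(2,1), of r] 
    unfolding q r t by (simp add: algebra_simps)
  have 4: "right_angle r t a" 
    using right_angle_vec[OF vperp_vneg[OF xy] ne(1) ne'(2), of t] unfolding r t by (simp add: algebra_simps)
  show ?thesis unfolding rectangle_def using 1 2 3 4 by blast
qed

text \<open>
  The common vertex of the two rectangles is placed at the origin.
\<close>

lemma equal_rectanglesI:
  assumes R: "rectangle P Q R S" "congr P Q org g" "congr Q R org e"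
    and R': "rectangle P' Q' R' S'" "congr P' Q' org g'" "congr Q' R' org e'"
    and perp: "vperp g e" "vperp g e'" "vperp g' e" "vperp g' e'"
    and ne: "g \<noteq> org" "e \<noteq> org" "g' \<noteq> org" "e' \<noteq> org"
    and b: "strict_bet (vneg e') org e" "strict_bet g org (vneg g')" 
      "strict_bet (g \<ominus> e') org (e \<ominus> g')"
  shows "equal_rectangles P Q R S P' Q' R' S'"
proof -
  have nn: "vneg x \<noteq> org" if "x \<noteq> org" for x using that by simp
  have 1: "rectangle (e \<oplus> g) e org g"
    by (rule rectangle_vec[OF vperp_vneg_left[OF vperp_vneg[OF perp(1)]] nn[OF ne(1)] nn[OF ne(2)]])
       (simp_all add: algebra_simps)
  have 2: "rectangle org (vneg g') (vneg e' \<ominus> g') (vneg e')"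
    by (rule rectangle_vec[OF vperp_vneg_left[OF vperp_vneg[OF perp(4)]] nn[OF ne(3)] nn[OF ne(4)]])
       (simp_all add: algebra_simps)
  have 3: "rectangle (vneg e') org g (g \<ominus> e')"
    by (rule rectangle_vec[OF vperp_sym[OF perp(2)] ne(4,1)]) (simp_all add: algebra_simps)
  have 4: "rectangle org (vneg g') (e \<ominus> g') e"
    by (rule rectangle_vec[OF vperp_vneg_left[OF perp(3)] nn[OF ne(3)] ne(2)]) (simp_all add: algebra_simps)
  have c: "congr P Q (e \<oplus> g) e" "congr Q R e org" 
    "congr P' Q' org (vneg g')" "congr Q' R' (vneg g') (vneg e' \<ominus> g')"
  proof -
    have "congr (e \<oplus> g) e org g" 
      unfolding congr_vec[of "e \<oplus> g"] using norm_vneg[of g] by (simp add: vsub_vadd_cancel)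
    moreover have "congr (vneg g') (vneg e' \<ominus> g') org e'"
      unfolding congr_vec[of "vneg g'"] using norm_vneg[of e'] by simp
    moreover have "congr org (vneg g') org g'" by (rule norm_vneg)
    ultimately show "congr P Q (e \<oplus> g) e" "congr Q R e org" 
      "congr P' Q' org (vneg g')" "congr Q' R' (vneg g') (vneg e' \<ominus> g')"
      using congr_trans[OF R(2) congr_sym] R(3) congr_right congr_trans[OF R'(2) congr_sym]
        congr_trans[OF R'(3) congr_sym] by blast+
  qed
  show ?thesis
    unfolding equal_rectangles_def congruent_rectangles_def 
    by (rule exI[of _ "vneg e'"], rule exI[of _ org], rule exI[of _ e], rule exI[of _ "e \<oplus> g"],
        rule exI[of _ g], rule exI[of _ "g \<ominus> e'"], rule exI[of _ "e \<ominus> g'"], 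
        rule exI[of _ "vneg e' \<ominus> g'"], rule exI[of _ "vneg g'"])
       (use R R' 1 2 3 4 c b in blast)
qed

lemma scaling_vperp:
  assumes "s \<noteq> org" "p \<noteq> org" "x \<noteq> org" "vperp x y"
  shows "vperp x (scaling s p y)"
  using assms vperp_iff_refl_in[OF assms(3)] scaling_refl_in[OF assms(1-3), of y] scaling_vneg[OF assms(1,2)] by metis

lemma refl_in_diff_vperp: "x \<noteq> org \<Longrightarrow> vperp x (b \<ominus> refl_in x b)"
  using vperp_iff_refl_in[of x] by (simp add: refl_in_vsub refl_in_invol)

lemma ray_representative:
  assumes "col org t b" "t \<noteq> org" "b \<noteq> org"
  shows "same_ray org t b \<or> same_ray org t (vneg b)"
proof (rule disjCI)
  assume "\<not> same_ray org t (vneg b)"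
  have "bet b org (vneg b)" unfolding vneg_def by (rule point_refl_bet)
  moreover have "vneg b \<noteq> org" using assms by simp
  ultimately show "same_ray org t b"
    using same_ray_or_opposite[OF assms] bet_connectivity_from[OF assms(3)] assms 
      \<open>\<not> same_ray org t (vneg b)\<close> bet_sym unfolding same_ray_def by metis
qed

lemma col_org_trans: "x \<noteq> org \<Longrightarrow> col org y x \<Longrightarrow> col org x z \<Longrightarrow> col org y z"
  using col_trans_through[of org x y z] col_rot col_swap by metis

section \<open>Heights over lines through the ends of a parallel to the base\<close>

text \<open>
  The map \<open>phi z = scaling s p (refl_in u z) \<oplus> z\<close> is linear, so if it takes one vector of a line to the line \<open>a\<close>,
  it takes them all there. To see this without coordinates, note that it commutes with every scaling and that,
  up to sign, the shorter of \<open>t\<close> and \<open>b\<close> is a scaling of the longer.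
\<close>

lemma col_scaling_refl_sum_along_line:
  assumes s: "s \<noteq> org" and p: "p \<noteq> org" and q: "scaling s p p \<noteq> org" "bet org (scaling s p p) p"
    and u: "u \<noteq> org"
    and t: "t \<noteq> org" "col org t b" and at: "col org a (scaling s p (refl_in u t) \<oplus> t)"
  shows "col org a (scaling s p (refl_in u b) \<oplus> b)"
proof -
  define phi where "phi z = scaling s p (refl_in u z) \<oplus> z" for z
  have pos: "col org a (phi b)" if r: "same_ray org t b" for b
  proof -
    have b0: "b \<noteq> org" using r same_ray_def by blast
    have comm: "phi (scaling v w z) = scaling v w (phi z)" if "v \<noteq> org" "w \<noteq> org" for v w z
      unfolding phi_def using that s p u by (simp add: scaling_vadd scaling_refl_in scaling_comm)
    consider "bet org b t" | "bet org t b" using r same_ray_def by blast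
    then show ?thesis
    proof cases
      case 1
      obtain v where v: "v \<noteq> org" "scaling v t t = b" using scaling_exists[OF t(1) b0 1] by blast
      show ?thesis
      proof (cases "phi t = org")
        case True
        then show ?thesis using comm[OF v(1) t(1), of t] v scaling_org t(1) col_triv by metis
      next
        case False
        have "same_ray org (phi t) (scaling v t (phi t))" 
          using scaling_ray[OF v(1) t(1) _ _ False] v b0 1 by simp
        then have "col org (phi t) (phi b)" using comm[OF v(1) t(1), of t] v 
          unfolding same_ray_def col_def using bet_sym by metis
        then show ?thesis using col_org_trans[OF False] at phi_def by metis
      qed
    next
      case 2
      obtain v where v: "v \<noteq> org" "scaling v b b = t" using scaling_exists[OF b0 t(1) 2] by blast
      show ?thesis
      proof (cases "phi b = org")
        case True then show ?thesis using col_triv by metis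
      next
        case False
        have r: "same_ray org (phi b) (scaling v b (phi b))" 
          using scaling_ray[OF v(1) b0 _ _ False] v t 2 by simp
        then have "phi t \<noteq> org" "col org (phi t) (phi b)" using comm[OF v(1) b0, of b] v 
          unfolding same_ray_def col_def using bet_sym by metis+
        then show ?thesis using col_org_trans at phi_def by metis
      qed
    qed
  qed
  show ?thesis
  proof (cases "b = org")
    case True then show ?thesis using scaling_org[OF s p] refl_in_org u col_triv by simp
  next
    case False
    have "phi (vneg b) = vneg (phi b)" 
      unfolding phi_def using s p u by (simp add: scaling_vneg refl_in_vneg V.minus_add V.add.commute)
    then have "col org a (phi b)" if "same_ray org t (vneg b)"
      using pos[OF that] col_org_vneg[of a "phi (vneg b)"] by simp
    then show ?thesis using ray_representative[OF t(2,1) False] pos phi_def by metis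
  qed
qed

text \<open>
  The vector \<open>h\<close> is the mirror image of the component of \<open>-2b\<close> orthogonal to \<open>q\<close>, under the reflection
  in \<open>u\<close> that takes the ray of \<open>q\<close> to that of \<open>p\<close>. Since \<open>w \<oplus> b\<close> lies on the line \<open>p\<close>, where \<open>w\<close> is the scaled mirror image
  of \<open>b\<close>, the components of \<open>w\<close> and \<open>-b\<close> orthogonal to \<open>p\<close> agree, and \<open>h\<close> is scaled to \<open>-2\<close> times the first one.
\<close>

lemma heights_matched_by_scaling:
  assumes p: "p \<noteq> org" and q: "q \<noteq> org" and le: "seg_le org q org p" 
    and bq: "col org b (q \<ominus> p)" and bq': "\<not> col org q b"
  shows "\<exists>M h. congr org (M p) org q \<and> congr org h org (b \<ominus> refl_in q b) 
    \<and> M h = b \<ominus> refl_in p b \<and> vperp p h \<and> h \<noteq> org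
    \<and> (\<forall>x y. M (x \<ominus> y) = M x \<ominus> M y) \<and> (\<forall>x. x \<noteq> org \<longrightarrow> same_ray org x (M x))
    \<and> (\<forall>x y. x \<noteq> org \<longrightarrow> vperp x y \<longrightarrow> vperp x (M y))"
proof -
  obtain q' where q': "same_ray org p q'" "congr org q' org q" using lay_off[of p org org q] p q by metis
  have q'0: "q' \<noteq> org" using q' same_ray_def by blast
  have q'p: "bet org q' p" 
    using ray_seg_le_bet[OF same_ray_sym[OF q'(1)]] seg_le_congr[OF le congr_sym[OF q'(2)] congr_refl] by blast
  have cq': "col org q' p" "col org p q'" using q'p unfolding col_def using bet_sym by blast+
  have "\<exists>s u. s \<noteq> org \<and> u \<noteq> org \<and> scaling s p p = q' \<and> refl_in u q = q' 
     \<and> col org p (scaling s p (refl_in u b) \<oplus> b)"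
  proof (cases "q = p")
    case True
    \<comment> \<open>\<open>q \<ominus> p\<close> gives no direction here, but the scaling by \<open>1\<close> and the reflection in \<open>p\<close> itself will do.\<close>
    have "mid p p = p" for p using mid_eq midp_same by metis
    then have m: "scaling p p z = z" for z unfolding scaling_def using p refl_in_invol by simp
    have "seg_le org p org q'" using seg_le_congr[OF le] True congr_refl congr_sym[OF q'(2)] q' by metis
    then have "bet org p q'" using ray_seg_le_bet[OF q'(1)] by blast
    then have "q' = p" using q'p bet_sym bet_antisym by metis
    moreover have "refl_in p (refl_in p b \<oplus> b) = refl_in p b \<oplus> b" using p by (simp add: refl_in_vadd refl_in_invol V.add.commute)
    ultimately show ?thesis using True p m refl_in_self refl_in_fixed by metis
  next
    case False
    obtain s where s: "s \<noteq> org" "scaling s p p = q'" using scaling_exists[OF p q'0 q'p] by blast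
    obtain u where u: "u \<noteq> org" "refl_in u q = q'" using refl_in_swap[OF q congr_sym[OF q'(2)]] by blast
    define t where "t = q \<ominus> p"
    have t: "t \<noteq> org" "col org t b" unfolding t_def using False col_rot[OF col_swap[OF bq]] by simp_all
    have "scaling s p (refl_in u p) = q" using scaling_refl_in[OF s(1) p u(1), of p] s u refl_in_invol by metis
    then have "scaling s p (refl_in u t) \<oplus> t = scaling s p q' \<ominus> p"
      unfolding t_def using s p u by (simp add: refl_in_vsub scaling_vsub algebra_simps)
    moreover have "same_ray org q' (scaling s p q')" using scaling_ray[OF s(1) p _ _ q'0] s q'0 q'p by simp
    then have "col org q' (scaling s p q')" unfolding same_ray_def col_def using bet_sym by blast
    then have "col org p (scaling s p q')" using col_org_trans[OF q'0 cq'(2)] by blast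
    ultimately have "col org p (scaling s p (refl_in u t) \<oplus> t)" 
      using col_org_vsub[of p "scaling s p q'" p] col_triv by simp
    then have "col org p (scaling s p (refl_in u b) \<oplus> b)"
      using col_scaling_refl_sum_along_line[OF s(1) p _ _ u(1) t] s q'0 q'p by simp
    then show ?thesis using s u by blast
  qed
  then obtain s u where s: "s \<noteq> org" "scaling s p p = q'" and u: "u \<noteq> org" "refl_in u q = q'" 
    and c: "col org p (scaling s p (refl_in u b) \<oplus> b)" by blast
  define M where "M = scaling s p"
  define h where "h = vneg (refl_in u (b \<ominus> refl_in q b))"
  define w where "w = M (refl_in u b)"
  have "refl_in p = refl_in q'" using refl_in_cong_line q'0 p cq' by metis
  then have swap: "refl_in u (refl_in q b) = refl_in p (refl_in u b)" 
    using refl_in_conj[OF u(1) q, of "refl_in u b"] u refl_in_invol by simp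
  then have "refl_in u (b \<ominus> refl_in q b) = refl_in u b \<ominus> refl_in p (refl_in u b)" using u by (simp add: refl_in_vsub)
  then have h: "h = vneg (refl_in u b \<ominus> refl_in p (refl_in u b))" unfolding h_def by simp
  have "M h = vneg (w \<ominus> refl_in p w)"
    unfolding h w_def M_def using s p by (simp add: scaling_vneg scaling_vsub scaling_refl_in)
  also have "\<dots> = b \<ominus> refl_in p b"
  proof -
    have "refl_in p (w \<oplus> b) = w \<oplus> b" using c refl_in_fixed[OF p] unfolding w_def M_def by blast
    then have "refl_in p w \<oplus> refl_in p b = w \<oplus> b" using p by (simp add: refl_in_vadd)
    then have "refl_in p w \<ominus> w = b \<ominus> refl_in p b" by (metis V.add.commute V.add_diff_cancel_left' V.diff_diff_eq2 V.diff_add_cancel V.add_diff_eq)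
    then show ?thesis by simp
  qed
  finally have Mh: "M h = b \<ominus> refl_in p b" .
  have "vperp p h" unfolding h using vperp_vneg[OF refl_in_diff_vperp[OF p]] .
  moreover have "congr org h org (b \<ominus> refl_in q b)"
    unfolding h_def using norm_vneg refl_in_norm[OF u(1)] congr_trans by blast
  moreover have "h \<noteq> org" 
  proof
    assume "h = org"
    then have "b = refl_in q b" unfolding h_def using refl_in_ne[OF u(1), of "b \<ominus> refl_in q b"] by auto
    then show False using bq' refl_in_fixed[OF q] by metis
  qed
  moreover have "congr org (M p) org q" unfolding M_def using s q' by simp
  moreover have "same_ray org x (M x)" if "x \<noteq> org" for x
    unfolding M_def using scaling_ray[OF s(1) p _ _ that] s q'0 q'p by simp
  moreover have "M (x \<ominus> y) = M x \<ominus> M y" for x y unfolding M_def using scaling_vsub[OF s(1) p] .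
  moreover have "vperp x (M y)" if "x \<noteq> org" "vperp x y" for x y
    unfolding M_def using scaling_vperp[OF s(1) p that] .
  ultimately show ?thesis using Mh by blast
qed

text \<open>
  The scaling shrinks, so the roles of \<open>p\<close> and \<open>q\<close> depend on which one is longer. Either way the three
  betweenness conditions are instances of the fact that the origin lies between \<open>x\<close> and \<open>- M x\<close>.
\<close>

lemma equal_rectangles_of_parallel:
  assumes R: "rectangle P Q R S" "congr P Q org p" "congr Q R org (b \<ominus> refl_in p b)"
    and R': "rectangle P' Q' R' S'" "congr P' Q' org q" "congr Q' R' org (b \<ominus> refl_in q b)"
    and bq: "col org b (q \<ominus> p)" and bp: "\<not> col org p b" and bq': "\<not> col org q b"
  shows "equal_rectangles P Q R S P' Q' R' S'"
proof -
  have ne: "p \<noteq> org" "q \<noteq> org" using bp bq' col_triv by blast+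
  have sbs: "strict_bet y org x" if "strict_bet x org y" for x y
    using that bet_sym[of x org y] unfolding strict_bet_def by blast
  have sb: "strict_bet (vneg x) org y" if "same_ray org x y" for x y
    using sbs[OF vneg_ray[OF same_ray_sym[OF that]]] .
  show ?thesis
  proof (cases "seg_le org q org p")
    case True
    obtain M h where M: "congr org (M p) org q" "congr org h org (b \<ominus> refl_in q b)"
      "M h = b \<ominus> refl_in p b" "vperp p h" "h \<noteq> org" "\<And>x y. M (x \<ominus> y) = M x \<ominus> M y" 
      "\<And>x. x \<noteq> org \<Longrightarrow> same_ray org x (M x)" "\<And>x y. x \<noteq> org \<Longrightarrow> vperp x y \<Longrightarrow> vperp x (M y)"
      using heights_matched_by_scaling[OF ne(1,2) True bq bq'] by blast
    have n: "M p \<noteq> org" "M h \<noteq> org" using M(7) ne M(5) same_ray_def by blast+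
    have v: "vperp p (M h)" "vperp (M p) h" "vperp (M p) (M h)"
      using M(8) M(4) vperp_sym ne M(5) n by blast+
    have "p \<ominus> h \<noteq> org" using vperp_ne[OF M(4) ne(1)] by simp
    then have "same_ray org (p \<ominus> h) (M (p \<ominus> h))" using M(7) by blast
    then have s3: "strict_bet (p \<ominus> h) org (M h \<ominus> M p)" using vneg_ray M(6) by force
    show ?thesis
      using equal_rectanglesI[OF R(1,2) _ R'(1) _ _ v(1) M(4) v(3,2) ne(1) n(2,1) M(5) _ _ s3]
        R R' M(1-3) congr_trans congr_sym sb[OF M(7)[OF M(5)]] vneg_ray[OF M(7)[OF ne(1)]] by metis
  next
    case False
    then have le: "seg_le org p org q" using seg_le_total by blast
    have bq2: "col org b (p \<ominus> q)" using col_org_vneg[OF bq] by simp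
    obtain M h where M: "congr org (M q) org p" "congr org h org (b \<ominus> refl_in p b)"
      "M h = b \<ominus> refl_in q b" "vperp q h" "h \<noteq> org" "\<And>x y. M (x \<ominus> y) = M x \<ominus> M y" 
      "\<And>x. x \<noteq> org \<Longrightarrow> same_ray org x (M x)" "\<And>x y. x \<noteq> org \<Longrightarrow> vperp x y \<Longrightarrow> vperp x (M y)"
      using heights_matched_by_scaling[OF ne(2,1) le bq2 bp] by blast
    have n: "M q \<noteq> org" "M h \<noteq> org" using M(7) ne M(5) same_ray_def by blast+
    have v: "vperp q (M h)" "vperp (M q) h" "vperp (M q) (M h)"
      using M(8) M(4) vperp_sym ne M(5) n by blast+
    have "q \<ominus> h \<noteq> org" using vperp_ne[OF M(4) ne(2)] by simp
    then have "same_ray org (q \<ominus> h) (M (q \<ominus> h))" using M(7) by blast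
    then have s3: "strict_bet (M q \<ominus> M h) org (h \<ominus> q)" using sbs[OF sb] M(6) by force
    show ?thesis
      using equal_rectanglesI[OF R(1) _ _ R'(1,2) _ v(2,3) M(4) v(1) n(1) M(5) ne(2) n(2) _ _ s3]
        R R' M(1-3) congr_trans congr_sym sbs[OF vneg_ray[OF M(7)[OF M(5)]]] sbs[OF sb[OF M(7)[OF ne(2)]]] 
        vneg_ray[OF same_ray_sym[OF M(7)[OF ne(2)]]] sb[OF same_ray_sym[OF M(7)[OF M(5)]]] by metis
  qed
qed


section \<open>Parallelograms and their circumscribed rectangles\<close>

lemma parallel_lines_par: "parallel_lines A B C D \<Longrightarrow> par A B C D"
  unfolding parallel_lines_def par_def line_def by blast

lemma par_translate:
  assumes "A \<noteq> B"
  shows "par A B (v \<oplus> A) (v \<oplus> B)"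
  unfolding vadd_def using par_trans[OF par_point_refl[OF assms] par_point_refl] 
    par_point_refl[OF assms] unfolding par_def by blast

text \<open>
  Translating \<open>AB\<close> to start at \<open>C\<close> gives a parallel to \<open>AB\<close> through \<open>C\<close>, so by Playfair it is the line \<open>CD\<close>.
\<close>

lemma parallel_lines_direction:
  assumes "parallel_lines A B C D"
  shows "col org (B \<ominus> A) (D \<ominus> C)"
proof -
  have AB: "A \<noteq> B" using assms unfolding parallel_lines_def by blast
  have "par A B C (C \<ominus> A \<oplus> B)" using par_translate[OF AB, of "C \<ominus> A"] by simp
  then have "par C (C \<ominus> A \<oplus> B) C D"
    using par_trans par_sym parallel_lines_par[OF assms] by blast
  then have "line C (C \<ominus> A \<oplus> B) = line C D" unfolding par_def using line_mem by blast
  then have "col C (C \<ominus> A \<oplus> B) D" using line_mem unfolding line_def by blast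
  then show ?thesis unfolding col_vec[of C] by (simp add: algebra_simps)
qed

lemma parallelogram_not_col:
  assumes "parallelogram A B C D"
  shows "\<not> col A B C"
  using assms col_triv unfolding parallelogram_def parallel_lines_def by blast

text \<open>
  The difference of the two vectors is a multiple of both \<open>B \<ominus> A\<close> and \<open>C \<ominus> B\<close>, which are
  independent.
\<close>

lemma parallelogram_vec:
  assumes "parallelogram A B C D"
  shows "D \<ominus> A = C \<ominus> B"
proof (rule ccontr)
  assume neq: "D \<ominus> A \<noteq> C \<ominus> B"
  define w where "w = (D \<ominus> A) \<ominus> (C \<ominus> B)"
  have w0: "w \<noteq> org" unfolding w_def using neq by simp
  have c1: "col org (B \<ominus> A) (D \<ominus> C)" and c2: "col org (D \<ominus> A) (C \<ominus> B)"
    using assms parallel_lines_direction unfolding parallelogram_def by blast+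
  have "w = (D \<ominus> C) \<oplus> (B \<ominus> A)" unfolding w_def by (simp add: algebra_simps)
  then have w1: "col org (B \<ominus> A) w" using col_org_vadd[OF c1] col_triv by blast
  have w2: "col org (C \<ominus> B) w" 
    unfolding w_def using col_org_vsub[of "C \<ominus> B" "D \<ominus> A"] c2 col_triv col_rot col_swap by metis
  have "col org (B \<ominus> A) (C \<ominus> B)" 
    using col_trans_through[OF w0[symmetric]] w1 w2 col_rot col_swap by metis
  then have "col org (C \<ominus> B) (vneg (B \<ominus> A))" 
    by (intro col_org_vneg) (rule col_swap[OF col_rot[OF col_rot]])
  then have "col B C A" unfolding col_vec[of B] by simp
  then show False using parallelogram_not_col[OF assms] col_rot by blast
qed

lemma parallelogram_convex:
  assumes "parallelogram A B C D"
  shows "convex_quadrilateral A B C D"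
proof -
  have n: "\<not> col A B C" using parallelogram_not_col[OF assms] .
  define X where "X = mid A C"
  have "point_refl X B = D" 
    unfolding point_refl_vec X_def mid_double using parallelogram_vec[OF assms] 
    by (metis V.add.commute V.add_diff_eq V.diff_add_cancel)
  then have b: "bet A X C" "bet B X D" "midp X B D" "midp X A C" 
    unfolding X_def using point_refl_bet point_refl_midp mid_midp midp_def by metis+
  have "A \<noteq> C" "\<not> col A C B" using n col_triv col_rot col_swap by metis+
  moreover have "col A C X" using b(1) bet_col col_rot col_swap by blast
  ultimately have "X \<noteq> A" "X \<noteq> C" "X \<noteq> B" using b(4) midp_start midp_end by metis+
  moreover have "X \<noteq> D" using \<open>X \<noteq> B\<close> b midp_end by metis
  ultimately have "strict_bet A X C \<and> strict_bet B X D" unfolding strict_bet_def using b by metis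
  moreover have "\<not> (\<exists>U V. U \<noteq> V \<and> col U V A \<and> col U V B \<and> col U V C \<and> col U V D)"
    using n col_of_line by blast
  ultimately show ?thesis unfolding convex_quadrilateral_def by blast
qed

lemma col_of_direction:
  assumes "A \<noteq> org" "col org A (Q \<ominus> P)" "col org A (X \<ominus> P)"
  shows "col P Q X"
  unfolding col_vec[of P] using col_trans_through[of org A] assms by metis

lemma parallel_lines_of_direction:
  assumes A: "A \<noteq> org" and PQ: "P \<noteq> Q" "col org A (Q \<ominus> P)" and P: "\<not> col org A P"
  shows "parallel_lines P Q org A"
  unfolding parallel_lines_def
proof (intro conjI notI)
  show "org = A \<Longrightarrow> False" "P = Q \<Longrightarrow> False" using A PQ by blast+
  assume "\<exists>X. col P Q X \<and> col org A X"
  then obtain X where X: "col org (Q \<ominus> P) (X \<ominus> P)" "col org A X" unfolding col_vec[of P] by blast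
  have "Q \<ominus> P \<noteq> org" using PQ by simp
  then have "col org A (X \<ominus> P)" using col_org_trans X PQ by blast
  then have "col org A P" using col_org_vsub[OF X(2)] vsub_vsub_cancel by metis
  then show False using P by blast
qed

text \<open>
  Let \<open>v\<close> be the component of \<open>B\<close> orthogonal to \<open>A\<close>, so that \<open>v \<oplus> v\<close> is \<open>B\<close> minus its mirror image. As the
  diagonal from the origin to \<open>A\<close> joins the midpoints of two sides of the rectangle, its vertices are \<open>v\<close>, \<open>A \<oplus> v\<close>, \<open>A \<ominus> v\<close>,
  \<open>vneg v\<close>.
\<close>

lemma circumscribed_exists:
  assumes n: "\<not> col org A B"
  shows "\<exists>P Q R S. circumscribed_along B org (A \<ominus> B) A P Q R S \<and> congr P Q org A 
    \<and> congr Q R org (B \<ominus> refl_in A B)"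
proof -
  have A: "A \<noteq> org" using n col_triv by blast
  define m where "m = mid B (refl_in A B)"
  define v where "v = B \<ominus> m"
  have "refl_in A m = m" unfolding m_def using refl_in_mid[OF A] refl_in_invol[OF A] mid_comm by metis
  then have mA: "col org A m" using refl_in_fixed[OF A] by blast
  have mm: "m \<oplus> m = B \<oplus> refl_in A B" unfolding m_def by (rule mid_double)
  have vv: "v \<oplus> v = B \<ominus> refl_in A B"
  proof -
    have "v \<oplus> v = (B \<oplus> B) \<ominus> (m \<oplus> m)" unfolding v_def by (simp add: algebra_simps)
    then show ?thesis unfolding mm by (simp add: algebra_simps)
  qed
  have "refl_in A v = vneg v"
  proof -
    have "refl_in A v \<oplus> v = (refl_in A B \<oplus> B) \<ominus> (m \<oplus> m)" 
      unfolding v_def using A \<open>refl_in A m = m\<close> by (simp add: refl_in_vsub algebra_simps)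
    then have "refl_in A v \<oplus> v = org" unfolding mm by (simp add: V.add.commute)
    then show ?thesis using V.eq_neg_iff_add_eq_0 by blast
  qed
  then have Av: "vperp A v" using vperp_iff_refl_in[OF A] by blast
  have vA: "\<not> col org A v"
  proof
    assume "col org A v"
    then have "col org A (v \<oplus> m)" using mA col_org_vadd by blast
    then show False using n unfolding v_def by simp
  qed
  then have v0: "v \<noteq> org" using col_triv by blast
  then have v2: "vneg v \<ominus> v \<noteq> org" using vneg_eq by simp
  have "refl_in A (vneg v \<ominus> v) = vneg (vneg v \<ominus> v)"
    using A \<open>refl_in A v = vneg v\<close> by (simp add: refl_in_vsub refl_in_vneg)
  then have A2: "vperp A (vneg v \<ominus> v)" using vperp_iff_refl_in[OF A] by blast
  have AA: "col org A A" "col org A (vneg A)" using col_triv col_org_vneg by blast+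
  have r: "rectangle v (A \<oplus> v) (A \<ominus> v) (vneg v)"
    by (rule rectangle_vec[OF A2 A v2]) (simp_all add: algebra_simps)
  have ne: "v \<noteq> A \<oplus> v" "A \<ominus> v \<noteq> vneg v" "vneg v \<noteq> v" "A \<oplus> v \<noteq> A \<ominus> v"
  proof -
    show "v \<noteq> A \<oplus> v" using A by simp
    show "A \<ominus> v \<noteq> vneg v" using A V.add_cancel_left_left unfolding vsub_def by metis
    show "vneg v \<noteq> v" using v0 vneg_eq by metis
    then show "A \<oplus> v \<noteq> A \<ominus> v" unfolding vsub_def by (metis V.add_left_imp_eq)
  qed
  have p1: "parallel_lines v (A \<oplus> v) org A" 
    by (rule parallel_lines_of_direction[OF A ne(1) _ vA]) (use AA in simp)
  have p2: "parallel_lines (A \<ominus> v) (vneg v) org A" 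
  proof (rule parallel_lines_of_direction[OF A ne(2)])
    show "col org A (vneg v \<ominus> (A \<ominus> v))" using AA by (simp add: algebra_simps)
    show "\<not> col org A (A \<ominus> v)" using col_org_vsub[OF AA(1), of "A \<ominus> v"] vA vsub_vsub_cancel by metis
  qed
  have c1: "col v (A \<oplus> v) B" 
    by (rule col_of_direction[OF A]) (use AA mA in \<open>simp_all add: v_def vsub_vsub_cancel\<close>)
  have c2: "col (A \<ominus> v) (vneg v) (A \<ominus> B)"
  proof (rule col_of_direction[OF A])
    show "col org A (vneg v \<ominus> (A \<ominus> v))" using AA by (simp add: algebra_simps)
    have "A \<ominus> B \<ominus> (A \<ominus> v) = vneg m" unfolding v_def by (simp add: algebra_simps)
    then show "col org A (A \<ominus> B \<ominus> (A \<ominus> v))" using col_org_vneg[OF mA] by simp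
  qed
  have b1: "bet v org (vneg v)" unfolding vneg_def by (rule point_refl_bet)
  then have c3: "col (vneg v) v org" using bet_col col_rot col_swap by blast
  have "bet (A \<oplus> v) A (A \<ominus> v)" using bet_translate[of A v org "vneg v"] b1 by simp
  then have c4: "col (A \<oplus> v) (A \<ominus> v) A" using bet_col col_rot col_swap by blast
  have ra1: "right_angle v org A" 
    by (rule right_angle_vecI) (use vperp_sym[OF Av] A v0 in simp_all)
  have ra2: "right_angle (A \<oplus> v) A org" 
    by (rule right_angle_vecI) (use vperp_vneg[OF vperp_sym[OF Av]] A v0 in simp_all)
  have q1: "perpendicular_lines (vneg v) v org A"
    unfolding perpendicular_lines_def using ne(3) A c3 ra1 col_triv by metis
  have q2: "perpendicular_lines (A \<oplus> v) (A \<ominus> v) org A"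
    unfolding perpendicular_lines_def using ne(4) A c4 ra2 col_triv by metis
  have "circumscribed_along B org (A \<ominus> B) A v (A \<oplus> v) (A \<ominus> v) (vneg v)"
    unfolding circumscribed_along_def using r p1 c1 p2 c2 q1 c3 q2 c4 by blast
  moreover have "congr v (A \<oplus> v) org A" unfolding congr_vec[of v] by (simp add: congr_refl)
  moreover have "congr (A \<oplus> v) (A \<ominus> v) org (B \<ominus> refl_in A B)"
  proof -
    have "A \<ominus> v \<ominus> (A \<oplus> v) = vneg (v \<oplus> v)" by (simp add: algebra_simps)
    then show ?thesis unfolding congr_vec[of "A \<oplus> v"] using norm_vneg[of "v \<oplus> v"] vv by simp
  qed
  ultimately show ?thesis by blast
qed

lemma parallelogram_at_origin:
  assumes "parallelogram A B org D"
  shows "D = A \<ominus> B" "\<not> col org A B"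
proof -
  have "D \<ominus> A = vneg B" using parallelogram_vec[OF assms] by simp
  then show "D = A \<ominus> B" unfolding vsub_def[of A] by (metis V.add.commute V.diff_add_cancel)
  show "\<not> col org A B" using parallelogram_not_col[OF assms] col_rot by blast
qed

lemma equal_parallelograms_at_origin:
  assumes ABD: "parallelogram A B org D" and EBF: "parallelogram E B org F"
    and UV: "parallel_lines U V B org" "col U V A" "col U V E"
  shows "equal_quadrilaterals A B org D E B org F"
proof -
  note D = parallelogram_at_origin[OF ABD] and F = parallelogram_at_origin[OF EBF]
  obtain P Q R S where R: "circumscribed_along B org D A P Q R S" "congr P Q org A" 
    "congr Q R org (B \<ominus> refl_in A B)"
    using circumscribed_exists[OF D(2)] D(1) by blast
  obtain P' Q' R' S' where R': "circumscribed_along B org F E P' Q' R' S'" "congr P' Q' org E" 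
    "congr Q' R' org (B \<ominus> refl_in E B)"
    using circumscribed_exists[OF F(2)] F(1) by blast
  have ne: "V \<ominus> U \<noteq> org" using UV(1) unfolding parallel_lines_def by auto
  have d: "col org (V \<ominus> U) (A \<ominus> U)" "col org (V \<ominus> U) (E \<ominus> U)" 
    using UV unfolding col_vec[of U] by blast+
  have "E \<ominus> A = (E \<ominus> U) \<ominus> (A \<ominus> U)" by (simp add: algebra_simps)
  then have "col org (V \<ominus> U) (E \<ominus> A)" using col_org_vsub[OF d(2,1)] by simp
  moreover have "col org (V \<ominus> U) B" 
    using parallel_lines_direction[OF UV(1)] col_org_vneg[of "V \<ominus> U" "org \<ominus> B"] by simp
  ultimately have "col org B (E \<ominus> A)" using col_trans_through[OF ne[symmetric]] by blast
  then have "equal_rectangles P Q R S P' Q' R' S'"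
    using equal_rectangles_of_parallel[of P Q R S A B P' Q' R' S' E] R R' D(2) F(2)
    unfolding circumscribed_along_def by blast
  then show ?thesis 
    unfolding equal_quadrilaterals_def circumscribed_rectangle_def
    using parallelogram_convex[OF ABD] parallelogram_convex[OF EBF] R(1) R'(1) by blast
qed

end

end


theorem lemma7p9:
  fixes A B C D E F :: "'a::euclidean_plane"
  assumes "parallelogram A B C D"
    and "parallelogram E B C F"
    and "\<exists>U V. parallel_lines U V B C \<and> col U V A \<and> col U V D \<and> col U V E \<and> col U V F"
  shows "equal_quadrilaterals A B C D E B C F"
  using equal_parallelograms_at_origin assms by blast

end
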